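(* Let $n\ge1$ and let $r\in(0,1)$ be fixed. For $L>0$ let $f_L$ be the hyperbolic Gaussian analytic function of intensity $L$ on the unit ball $\mathbb B_n\subset\mathbb C^n$, and let $Z_{f_L}=\{z\in\mathbb B_n: f_L(z)=0\}$. There exist $C_1=C_1(n,r)>0$, $C_2=C_2(n,r)>0$ and $L_0$ such that for all $L\ge L_0$, \[ e^{-C_1L^{n+1}}\le \mathbb P\left[Z_{f_L}\cap B(0,r)=\emptyset\right]\le e^{-C_2L^{n+1}} , \] where $B(0,r)=\{z\in\mathbb C^n:|z|<r\}$.
   Context: For real $L>0$, the hyperbolic Gaussian analytic function of intensity $L$ is the random holomorphic function \[ f_L(z)=\sum_{\alpha} a_\alpha\left(\frac{\Gamma(L+|\alpha|)}{\alpha!\,\Gamma(L)}\right)^{1/2}z^\alpha,\qquad z\in\mathbb B_n=\{z\in\mathbb C^n:|z|<1\}, \] where $\alpha$ ranges over multi-indices in $\mathbb Z_{\ge0}^n$ and the $a_\alpha$ are i.i.d. standard complex Gaussians (mean $0$, $\mathbb E|a_\alpha|^2=1$). Its covariance kernel is $K_L(z,w)=\mathbb E[f_L(z)\overline{f_L(w)}]=(1-z\cdot\bar w)^{-L}$. *)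

theory Defs
  imports "HOL-Probability.Probability"
begin

text \<open>
  \<open>\<complex>\<^sup>n\<close> is rendered as \<^typ>\<open>complex ^ 'n\<close>, so that \<open>n\<close> is \<open>CARD('n)\<close>, and a multi-index is a
  function \<^typ>\<open>'n \<Rightarrow> nat\<close>.
\<close>

definition mi_size :: "('n::finite \<Rightarrow> nat) \<Rightarrow> nat" where
  "mi_size \<alpha> = (\<Sum>i\<in>UNIV. \<alpha> i)"

definition mi_fact :: "('n::finite \<Rightarrow> nat) \<Rightarrow> real" where
  "mi_fact \<alpha> = (\<Prod>i\<in>UNIV. fact (\<alpha> i))"

definition mi_power :: "complex ^ 'n \<Rightarrow> ('n::finite \<Rightarrow> nat) \<Rightarrow> complex" where
  "mi_power z \<alpha> = (\<Prod>i\<in>UNIV. (z $ i) ^ \<alpha> i)"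

text \<open>
  The density \<open>exp (- |z|\<^sup>2) / \<pi>\<close> with respect to Lebesgue measure on \<open>\<complex>\<close> is that of the circularly
  symmetric Gaussian with mean \<open>0\<close> and \<open>E |X|\<^sup>2 = 1\<close> (real and imaginary parts have variance \<open>1/2\<close>).
\<close>

definition standard_complex_gaussian :: "'w measure \<Rightarrow> ('w \<Rightarrow> complex) \<Rightarrow> bool" where
  "standard_complex_gaussian M X \<longleftrightarrow>
     distributed M lborel X (\<lambda>z. ennreal (exp (- (cmod z)\<^sup>2) / pi))"

definition iid_standard_complex_gaussians :: "'w measure \<Rightarrow> ('i \<Rightarrow> 'w \<Rightarrow> complex) \<Rightarrow> bool" where
  "iid_standard_complex_gaussians M a \<longleftrightarrow>
     prob_space.indep_vars M (\<lambda>_. borel) a UNIV \<and> (\<forall>\<alpha>. standard_complex_gaussian M (a \<alpha>))"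

text \<open>
  The sum is unordered, that is, absolutely convergent: for i.i.d. standard complex Gaussian
  coefficients this holds almost surely at every point of the unit ball. Where the sum does not
  converge, its value is the default \<open>0\<close>.
\<close>

definition hyperbolic_GAF ::
    "real \<Rightarrow> (('n::finite \<Rightarrow> nat) \<Rightarrow> 'w \<Rightarrow> complex) \<Rightarrow> 'w \<Rightarrow> complex ^ 'n \<Rightarrow> complex" where
  "hyperbolic_GAF L a \<omega> z =
     (\<Sum>\<^sub>\<infinity>\<alpha>. a \<alpha> \<omega> *
        complex_of_real (sqrt (Gamma (L + real (mi_size \<alpha>)) / (mi_fact \<alpha> * Gamma L))) *
        mi_power z \<alpha>)"

definition zero_set :: "(complex ^ 'n::finite \<Rightarrow> complex) \<Rightarrow> (complex ^ 'n) set" where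
  "zero_set f = {z \<in> ball 0 1. f z = 0}"

end

theory Submission
  imports Defs "HOL-Complex_Analysis.Complex_Analysis"
begin

text \<open>
  Let \<open>\<sigma>\<^sub>\<alpha>\<close> be the coefficient of \<open>a\<^sub>\<alpha> z\<^sup>\<alpha>\<close>.

  Lower bound: since \<open>\<sigma>\<^sub>\<alpha> |z\<^sup>\<alpha>|\<close> is at most \<open>e\<close> to the power \<open>O(L)\<close> times a geometric factor in \<open>|\<alpha>|\<close>,
  the constant term dominates as soon as \<open>|a\<^sub>0| \<ge> 1/2\<close> and all other \<open>|a\<^sub>\<alpha>|\<close> lie below a threshold
  that is exponentially small in \<open>L\<close> at \<open>\<alpha> = 0\<close> and grows geometrically in \<open>|\<alpha>|\<close>. Only the
  \<open>O(L\<^sup>n)\<close> indices with \<open>|\<alpha>| = O(L)\<close> contribute to the cost, each a factor of exponential order in \<open>L\<close>.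

  Upper bound: restrict \<open>f\<close> to the curve \<open>t \<mapsto> (\<rho> t\<^bsup>d(i)\<^esup>)\<^sub>i\<close>, where the \<open>d(i)\<close> are the powers of a base
  \<open>2m\<close>, \<open>m\<close> of order \<open>L\<close>. The Taylor coefficients \<open>\<phi>\<^sub>j\<close> of the restriction \<open>\<phi>\<close> are sums of the Gaussian
  terms over disjoint sets of multi-indices, hence independent, and \<open>m\<^sup>n\<close> of them have exponentially
  large variance. If \<open>\<phi>\<close> has no zeros in the unit disc, write \<open>\<phi> = \<phi>\<^sub>0 e\<^sup>g\<close>. Then \<open>\<phi>\<^sub>0 g\<^sub>j\<close> is \<open>\<phi>\<^sub>j\<close>
  minus a function of \<open>\<phi>\<^sub>0, \<dots>, \<phi>\<^sub>j\<^sub>-\<^sub>1\<close>, while Borel-Caratheodory bounds it, because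
  \<open>|\<phi>\<^sub>0| log (1/|\<phi>\<^sub>0|)\<close> is bounded even when \<open>\<phi>\<^sub>0\<close> is tiny. So, given the previous coefficients, each
  of those \<open>m\<^sup>n\<close> coefficients has to fall into a disc which it hits with exponentially small probability.
\<close>

subsection \<open>Coefficients of zero-free power series\<close>

text \<open>The Moebius map \<open>u / (2 * M - u)\<close> sends the half-plane Re u < M into the
  unit disc and fixes 0, so the Schwarz lemma applies to its composition with
  \<open>g\<close>.\<close>

lemma Borel_Caratheodory_centered:
  assumes "g holomorphic_on ball 0 1" "g 0 = 0"
    and "\<And>z. norm z < 1 \<Longrightarrow> Re (g z) < M" and "norm z < 1"
  shows "norm (g z) \<le> 2 * M * norm z / (1 - norm z)"
proof -
  have M: "M > 0"
    using assms(3)[of 0] assms(2) by simp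
  have ne: "2 * of_real M - g w \<noteq> 0" if "norm w < 1" for w
  proof
    assume "2 * of_real M - g w = 0"
    then have "Re (g w) = 2 * M" by (simp add: complex_eq_iff)
    with assms(3)[OF that] M show False by simp
  qed
  define w where "w = (\<lambda>z. g z / (2 * of_real M - g z))"
  have hol: "w holomorphic_on ball 0 1"
    unfolding w_def using ne by (intro holomorphic_intros assms) auto
  have lt: "norm (w z) < 1" if "norm z < 1" for z
  proof -
    have "(Re (g z))\<^sup>2 + (Im (g z))\<^sup>2 < (2 * M - Re (g z))\<^sup>2 + (Im (g z))\<^sup>2"
      using assms(3)[OF that] M by (simp add: power2_eq_square algebra_simps)
    then have "norm (g z) < norm (2 * of_real M - g z)"
      by (simp add: cmod_def)
    then show ?thesis unfolding w_def norm_divide using ne[OF that] by simp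
  qed
  have le: "norm (w z) \<le> norm z"
    by (rule Schwarz_Lemma(1)[OF hol _ lt]) (use assms in \<open>auto simp: w_def\<close>)
  \<comment> \<open>Inverts the Moebius map; the factor \<open>1 + w z\<close> is then bounded below
    through the Schwarz bound.\<close>
  have eq: "g z * (1 + w z) = 2 * M * w z"
    unfolding w_def using ne[OF assms(4)] by (simp add: field_simps)
  have "1 - norm z \<le> 1 - norm (w z)" using le by simp
  also have "\<dots> \<le> norm (1 + w z)"
    using norm_triangle_ineq2[of 1 "- w z"] by simp
  finally have "norm (g z) * (1 - norm z) \<le> norm (g z) * norm (1 + w z)"
    by (intro mult_left_mono) auto
  also have "\<dots> = 2 * M * norm (w z)"
    unfolding norm_mult[symmetric] eq using M by (simp add: norm_mult)
  also have "\<dots> \<le> 2 * M * norm z" using le M by simp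
  finally show ?thesis using assms(4) by (simp add: field_simps)
qed

text \<open>Cauchy's inequality on the circle of radius \<open>R = j / (j + 1)\<close>: there
  \<open>1 / (1 - R) = j + 1\<close>, while \<open>1 / R ^ j\<close> stays below
  \<open>exp 1\<close>, so the loss is only linear in \<open>j\<close>.\<close>

lemma Taylor_coeff_bound_Re:
  assumes hol: "g holomorphic_on ball 0 1" and "g 0 = 0"
    and Re: "\<And>z. norm z < 1 \<Longrightarrow> Re (g z) < M" and "j \<ge> 1"
  shows "norm ((deriv ^^ j) g 0 / fact j) \<le> 2 * exp 1 * (real j + 1) * M"
proof -
  have M: "M > 0"
    using assms(3)[of 0] assms(2) by simp
  define R :: real where "R = j / (j + 1)"
  have R: "0 < R" "R < 1" and R1: "1 - R = 1 / (j + 1)"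
    using \<open>j \<ge> 1\<close> by (auto simp: R_def field_simps)
  have "norm (g z) \<le> 2 * M * (j + 1)" if "norm (0 - z) = R" for z
  proof -
    have "norm (g z) \<le> 2 * M * norm z / (1 - norm z)"
      using that R by (intro Borel_Caratheodory_centered assms) auto
    also have "\<dots> = 2 * M * (R * (j + 1))" using that R1 by simp
    also have "\<dots> \<le> 2 * M * (1 * (j + 1))"
      using R M by (intro mult_left_mono mult_right_mono) auto
    finally show ?thesis by simp
  qed
  then have "norm ((deriv ^^ j) g 0) \<le> fact j * (2 * M * (j + 1)) / R ^ j"
    using R by (intro Cauchy_inequality holomorphic_on_imp_continuous_on
       holomorphic_on_subset[OF hol]) auto
  moreover have "1 / R ^ j \<le> exp 1"
  proof -
    have "1 / R = 1 + 1 / j" using \<open>j \<ge> 1\<close> by (simp add: R_def field_simps)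
    also have "\<dots> \<le> exp (1 / j)" by (rule exp_ge_add_one_self)
    finally have "(1 / R) ^ j \<le> exp (1 / j) ^ j" using R by (intro power_mono) auto
    also have "\<dots> = exp 1" using \<open>j \<ge> 1\<close> by (simp flip: exp_of_nat_mult)
    finally show ?thesis by (simp add: power_one_over)
  qed
  then have "fact j * (2 * M * (j + 1)) * (1 / R ^ j) \<le> fact j * (2 * M * (j + 1)) * exp 1"
    using M by (intro mult_left_mono) auto
  ultimately show ?thesis by (simp add: norm_divide field_simps)
qed

text \<open>
  The recursion compares coefficients in \<open>\<phi>' = g' \<phi>\<close>, where \<open>\<phi> = c\<^sub>0 e\<^sup>g\<close>. The value at \<open>j = 0\<close> is junk.
\<close>

fun log_coeff :: "(nat \<Rightarrow> complex) \<Rightarrow> nat \<Rightarrow> complex" where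
  "log_coeff c j =
     (c j - (\<Sum>i\<in>{1..<j}. of_nat i * log_coeff c i * c (j - i)) / of_nat j) / c 0"

declare log_coeff.simps [simp del]

text \<open>The part of \<open>c j\<close> that the earlier coefficients determine: if
  \<open>c 0 \<noteq> 0\<close>, then
  \<open>c j - log_rest c j = c 0 * log_coeff c j\<close>.\<close>

definition log_rest :: "(nat \<Rightarrow> complex) \<Rightarrow> nat \<Rightarrow> complex" where
  "log_rest c j = (\<Sum>i\<in>{1..<j}. of_nat i * log_coeff c i * c (j - i)) / of_nat j"

lemma log_coeff_cong: "(\<And>i. i \<le> j \<Longrightarrow> c i = d i) \<Longrightarrow> log_coeff c j = log_coeff d j"
proof (induction j rule: less_induct)
  case (less j)
  have "log_coeff c i = log_coeff d i" if "i \<in> {1..<j}" for i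
    using that less.prems by (intro less.IH) auto
  then show ?case
    unfolding log_coeff.simps[of c j] log_coeff.simps[of d j] using less.prems
    by (intro arg_cong2[where f = "(/)"] arg_cong2[where f = minus] sum.cong) auto
qed

text \<open>The strict inequality is what allows conditioning: \<open>log_rest c j\<close> stays
  fixed while a Gaussian that first enters in degree \<open>j\<close> varies.\<close>

lemma log_rest_cong: "(\<And>i. i < j \<Longrightarrow> c i = d i) \<Longrightarrow> log_rest c j = log_rest d j"
  unfolding log_rest_def
  by (intro arg_cong2[where f = "(/)"] sum.cong arg_cong2[where f = "(*)"] log_coeff_cong) auto

lemma measurable_log_coeff:
  assumes "\<And>i. (\<lambda>x. c x i) \<in> borel_measurable M"
  shows "(\<lambda>x. log_coeff (c x) j) \<in> borel_measurable M"
proof (induction j rule: less_induct)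
  case (less j)
  have [measurable]: "\<And>i. (\<lambda>x. c x i) \<in> borel_measurable M" by (rule assms)
  have [measurable]: "(\<lambda>x. \<Sum>i\<in>{1..<j}. of_nat i * log_coeff (c x) i * c x (j - i)) \<in> borel_measurable M"
    using less by (intro borel_measurable_sum borel_measurable_times assms) auto
  show ?case by (subst log_coeff.simps) measurable
qed

lemma measurable_log_rest:
  assumes "\<And>i. (\<lambda>x. c x i) \<in> borel_measurable M"
  shows "(\<lambda>x. log_rest (c x) j) \<in> borel_measurable M"
proof -
  have [measurable]: "\<And>i. (\<lambda>x. c x i) \<in> borel_measurable M"
    "\<And>i. (\<lambda>x. log_coeff (c x) i) \<in> borel_measurable M"
    by (intro assms measurable_log_coeff)+
  show ?thesis unfolding log_rest_def by measurable
qed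

text \<open>Differentiation makes the exponential relation linear in \<open>g\<close>. In degree
  \<open>j\<close> the only contribution not settled by induction is
  \<open>of_nat j * fps_nth G j * c 0\<close>, so the equation can be solved for it.\<close>

lemma log_coeff_eq_Taylor:
  assumes \<phi>: "\<phi> has_fps_expansion Abs_fps c" and g: "g has_fps_expansion G"
    and eq: "\<And>z. norm z < 1 \<Longrightarrow> \<phi> z = c 0 * exp (g z)"
    and hol: "g holomorphic_on ball 0 1" and c0: "c 0 \<noteq> 0" and "j \<ge> 1"
  shows "log_coeff c j = fps_nth G j"
proof -
  have "eventually (\<lambda>z. z \<in> ball 0 1) (nhds (0::complex))"
    by (intro eventually_nhds_in_open) auto
  then have ev: "eventually (\<lambda>z. deriv \<phi> z = deriv g z * \<phi> z) (nhds 0)"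
  proof eventually_elim
    case (elim z)
    have "(\<phi> has_field_derivative c 0 * (exp (g z) * deriv g z)) (at z)"
    proof (rule has_field_derivative_transform_within_open[where S = "ball 0 1"])
      show "((\<lambda>z. c 0 * exp (g z)) has_field_derivative c 0 * (exp (g z) * deriv g z)) (at z)"
        using elim by (intro DERIV_cmult DERIV_fun_exp holomorphic_derivI[OF hol]) auto
    qed (use elim eq in \<open>auto simp: dist_norm\<close>)
    then show ?case using eq elim by (auto dest!: DERIV_imp_deriv)
  qed
  have "(\<lambda>z. deriv g z * \<phi> z) has_fps_expansion fps_deriv G * Abs_fps c"
    by (intro has_fps_expansion_mult has_fps_expansion_deriv \<phi> g)
  moreover have "deriv \<phi> has_fps_expansion fps_deriv (Abs_fps c)"
    by (intro has_fps_expansion_deriv \<phi>)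
  ultimately have "fps_deriv G * Abs_fps c = fps_deriv (Abs_fps c)"
    using ev has_fps_expansion_cong[OF ev refl] fps_expansion_unique_complex by blast
  then have coeff: "of_nat j * c j = (\<Sum>i\<in>{1..j}. of_nat i * fps_nth G i * c (j - i))" if "j \<ge> 1" for j
  proof -
    obtain k where k: "j = Suc k" using \<open>j \<ge> 1\<close> by (cases j) auto
    have "fps_nth (fps_deriv (Abs_fps c)) k = fps_nth (fps_deriv G * Abs_fps c) k"
      using \<open>fps_deriv G * Abs_fps c = fps_deriv (Abs_fps c)\<close> by simp
    then have "of_nat j * c j = (\<Sum>i=0..k. of_nat (Suc i) * fps_nth G (Suc i) * c (j - Suc i))"
      unfolding fps_mult_nth k by (simp del: of_nat_Suc)
    also have "\<dots> = (\<Sum>i\<in>{1..j}. of_nat i * fps_nth G i * c (j - i))"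
      unfolding k One_nat_def sum.shift_bounds_cl_Suc_ivl ..
    finally show ?thesis .
  qed
  show ?thesis using \<open>j \<ge> 1\<close>
  proof (induction j rule: less_induct)
    case (less j)
    have "{1..j} = insert j {1..<j}" using less.prems by auto
    then have "of_nat j * c j = of_nat j * fps_nth G j * c 0
        + (\<Sum>i\<in>{1..<j}. of_nat i * fps_nth G i * c (j - i))"
      using coeff[OF less.prems] by simp
    also have "(\<Sum>i\<in>{1..<j}. of_nat i * fps_nth G i * c (j - i))
       = (\<Sum>i\<in>{1..<j}. of_nat i * log_coeff c i * c (j - i))"
      using less.IH by (intro sum.cong) auto
    finally show ?case
      using c0 less.prems by (subst log_coeff.simps) (simp add: field_simps)
  qed
qed

text \<open>
  \<open>|c\<^sub>0|\<close> is not bounded from below: the loss \<open>log (1/|c\<^sub>0|)\<close> in Borel-Caratheodory is absorbed by the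
  factor \<open>|c\<^sub>0|\<close>. The bound must be polynomial in \<open>j\<close>, which will be of order \<open>L\<^sup>n\<close>.
\<close>

lemma nonvanishing_coeff_bound:
  assumes sums: "\<And>t. norm t < 1 \<Longrightarrow> (\<lambda>j. c j * t ^ j) sums \<phi> t"
    and nz: "\<And>t. norm t < 1 \<Longrightarrow> \<phi> t \<noteq> 0"
    and bd: "\<And>t. norm t < 1 \<Longrightarrow> norm (\<phi> t) \<le> exp B" and "B \<ge> 0" "j \<ge> 1"
  shows "norm (c j - log_rest c j) \<le> 2 * exp 1 * (real j + 1) * (norm (c 0) * (B + 1) + 1)"
proof -
  have hol: "\<phi> holomorphic_on ball 0 1"
    using sums by (intro power_series_holomorphic[where a = c]) auto
  obtain h where h: "h holomorphic_on ball 0 1" "\<And>z. z \<in> ball 0 1 \<Longrightarrow> \<phi> z = exp (h z)"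
    using contractible_imp_holomorphic_log[OF hol convex_imp_contractible[OF convex_ball]] nz
    by auto
  have \<phi>0: "\<phi> 0 = c 0"
    using sums_unique[OF sums[of 0]] by simp
  \<comment> \<open>Normalised to \<open>g 0 = 0\<close>, so that \<phi> =
    \<open>c 0 * exp g\<close> and the centered Borel-Caratheodory estimate applies.\<close>
  define g where "g = (\<lambda>z. h z - h 0)"
  have g: "g holomorphic_on ball 0 1" "g 0 = 0"
    unfolding g_def by (intro holomorphic_intros h, simp)
  have eq: "\<phi> z = c 0 * exp (g z)" if "norm z < 1" for z
    using h(2)[of z] h(2)[of 0] \<phi>0 that by (simp add: g_def exp_diff)
  have c0: "c 0 \<noteq> 0" using nz[of 0] \<phi>0 by simp
  have fps: "\<phi> has_fps_expansion Abs_fps c"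
  proof (rule has_fps_expansionI)
    have "eventually (\<lambda>z. z \<in> ball 0 1) (nhds (0::complex))"
      by (intro eventually_nhds_in_open) auto
    then show "\<forall>\<^sub>F u in nhds 0. (\<lambda>n. fps_nth (Abs_fps c) n * u ^ n) sums \<phi> u"
      by eventually_elim (use sums in auto)
  qed
  have "g analytic_on {0}"
    using g(1) by (subst analytic_at) (auto intro!: exI[of _ "ball 0 1"])
  then have gfps: "g has_fps_expansion fps_expansion g 0"
    by (rule analytic_at_imp_has_fps_expansion_0)
  have "c j - log_rest c j = c 0 * log_coeff c j"
    using c0 by (simp add: log_rest_def log_coeff.simps[of c j])
  also have "log_coeff c j = (deriv ^^ j) g 0 / fact j"
    using log_coeff_eq_Taylor[OF fps gfps eq g(1) c0 \<open>j \<ge> 1\<close>] by (simp add: fps_expansion_def)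
  finally have "norm (c j - log_rest c j) = norm (c 0) * norm ((deriv ^^ j) g 0 / fact j)"
    by (simp add: norm_mult norm_divide)
  \<comment> \<open>Here Re g = log |\<phi>| - log |c 0|; the added 1 turns the weak bound
    \<open>bd\<close> into the strict one that is required.\<close>
  also have "norm ((deriv ^^ j) g 0 / fact j) \<le> 2 * exp 1 * (real j + 1) * (B - ln (norm (c 0)) + 1)"
  proof (rule Taylor_coeff_bound_Re[OF g _ \<open>j \<ge> 1\<close>])
    fix z :: complex assume z: "norm z < 1"
    have "norm (c 0) * exp (Re (g z)) \<le> exp B"
      using bd[OF z] eq[OF z] by (simp add: norm_mult)
    then have "ln (norm (c 0) * exp (Re (g z))) \<le> ln (exp B)"
      using c0 by (subst ln_le_cancel_iff) auto
    then show "Re (g z) < B - ln (norm (c 0)) + 1"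
      using c0 by (simp add: ln_mult)
  qed
  also have "norm (c 0) * (2 * exp 1 * (real j + 1) * (B - ln (norm (c 0)) + 1))
     = 2 * exp 1 * (real j + 1) * (norm (c 0) * (B + 1) + norm (c 0) * ln (1 / norm (c 0)))"
    using c0 by (simp add: ln_div algebra_simps)
  \<comment> \<open>The inequality \<open>ln y \<le> y - 1\<close> at
    \<open>y = 1 / norm (c 0)\<close> bounds s log (1/s) by 1 - s, uniformly as \<open>c 0\<close>
    tends to 0.\<close>
  also have "norm (c 0) * ln (1 / norm (c 0)) \<le> norm (c 0) * (1 / norm (c 0) - 1)"
    using c0 by (intro mult_left_mono ln_le_minus_one) auto
  also have "\<dots> \<le> 1" using c0 by (simp add: field_simps)
  finally show ?thesis by (simp add: mult_left_mono)
qed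

subsection \<open>Multi-indices and the coefficients of the series\<close>

lemma power_power_commute: "((x::'a::monoid_mult) ^ m) ^ n = (x ^ n) ^ m"
  by (simp add: mult.commute flip: power_mult)

lemma le_mi_size: "\<alpha> i \<le> mi_size \<alpha>"
  unfolding mi_size_def by (rule member_le_sum) auto

lemma finite_mi_size_le: "finite {\<alpha> :: 'n::finite \<Rightarrow> nat. mi_size \<alpha> \<le> K}"
  and card_mi_size_le: "card {\<alpha> :: 'n::finite \<Rightarrow> nat. mi_size \<alpha> \<le> K} \<le> (K + 1) ^ CARD('n)"
proof -
  have sub: "{\<alpha> :: 'n \<Rightarrow> nat. mi_size \<alpha> \<le> K} \<subseteq> Pi\<^sub>E UNIV (\<lambda>_. {..K})"
    using le_mi_size le_trans by fastforce
  then show "finite {\<alpha> :: 'n \<Rightarrow> nat. mi_size \<alpha> \<le> K}"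
    by (rule finite_subset) (intro finite_PiE, auto)
  show "card {\<alpha> :: 'n \<Rightarrow> nat. mi_size \<alpha> \<le> K} \<le> (K + 1) ^ CARD('n)"
    using card_mono[OF _ sub] by (simp add: card_PiE finite_PiE)
qed

text \<open>Enlarging \<open>S\<close> to a box of multi-indices makes the sum factor into
  \<open>CARD('n)\<close> geometric sums.\<close>

lemma sum_power_mi_size_le:
  fixes x :: real and S :: "('n::finite \<Rightarrow> nat) set"
  assumes "finite S" "0 \<le> x" "x < 1"
  shows "(\<Sum>\<alpha>\<in>S. x ^ mi_size \<alpha>) \<le> 1 / (1 - x) ^ CARD('n)"
proof -
  define K where "K = Max (insert 0 (mi_size ` S))"
  have K: "mi_size \<alpha> \<le> K" if "\<alpha> \<in> S" for \<alpha>
    unfolding K_def using assms that by (intro Max_ge) auto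
  have "S \<subseteq> Pi\<^sub>E UNIV (\<lambda>_. {..K})"
    using K le_mi_size le_trans by fastforce
  then have "(\<Sum>\<alpha>\<in>S. x ^ mi_size \<alpha>) \<le> (\<Sum>\<alpha>\<in>Pi\<^sub>E (UNIV :: 'n set) (\<lambda>_. {..K}). x ^ mi_size \<alpha>)"
    using assms by (intro sum_mono2 finite_PiE) auto
  also have "\<dots> = (\<Prod>i\<in>(UNIV :: 'n set). \<Sum>k\<in>{..K}. x ^ k)"
    unfolding mi_size_def power_sum by (subst prod_sum_PiE) auto
  also have "\<dots> \<le> (\<Prod>i\<in>(UNIV :: 'n set). 1 / (1 - x))"
  proof (intro prod_mono conjI sum_nonneg)
    have "(\<Sum>k\<in>{..K}. x ^ k) \<le> (\<Sum>k. x ^ k)"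
      using assms by (intro sum_le_suminf summable_geometric) auto
    then show "(\<Sum>k\<in>{..K}. x ^ k) \<le> 1 / (1 - x)"
      using assms by (simp add: suminf_geometric)
  qed (use assms in auto)
  finally show ?thesis by (simp add: power_one_over)
qed

lemma summable_power_mi_size:
  fixes x :: real
  assumes "0 \<le> x" "x < 1"
  shows "(\<lambda>\<alpha> :: 'n::finite \<Rightarrow> nat. x ^ mi_size \<alpha>) summable_on UNIV"
    and infsum_power_mi_size_le:
      "(\<Sum>\<^sub>\<infinity>\<alpha> :: 'n::finite \<Rightarrow> nat. x ^ mi_size \<alpha>) \<le> 1 / (1 - x) ^ CARD('n)"
proof -
  show s: "(\<lambda>\<alpha> :: 'n::finite \<Rightarrow> nat. x ^ mi_size \<alpha>) summable_on UNIV"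
    using assms sum_power_mi_size_le[OF _ assms, where 'n = 'n]
    by (intro nonneg_bdd_above_summable_on) (auto simp: bdd_above_def)
  show "(\<Sum>\<^sub>\<infinity>\<alpha> :: 'n::finite \<Rightarrow> nat. x ^ mi_size \<alpha>) \<le> 1 / (1 - x) ^ CARD('n)"
    by (rule infsum_le_finite_sums[OF s]) (use sum_power_mi_size_le assms in auto)
qed

section \<open>Upper and lower bounds for the coefficients of the series\<close>

lemma multinomial_term_le:
  fixes x :: "'i \<Rightarrow> real"
  assumes "finite I" "\<And>i. x i \<ge> 0"
  shows "(\<Prod>i\<in>I. x i ^ \<alpha> i / fact (\<alpha> i)) \<le> (\<Sum>i\<in>I. x i) ^ (\<Sum>i\<in>I. \<alpha> i) / fact (\<Sum>i\<in>I. \<alpha> i)"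
  using assms(1)
proof induction
  case (insert i I)
  define y b where "y = (\<Sum>i\<in>I. x i)" and "b = (\<Sum>i\<in>I. \<alpha> i)"
  have y: "y \<ge> 0" unfolding y_def using assms by (intro sum_nonneg) auto
  have "(\<Prod>i\<in>insert i I. x i ^ \<alpha> i / fact (\<alpha> i)) = x i ^ \<alpha> i / fact (\<alpha> i) * (\<Prod>i\<in>I. x i ^ \<alpha> i / fact (\<alpha> i))"
    using insert by simp
  also have "\<dots> \<le> x i ^ \<alpha> i / fact (\<alpha> i) * (y ^ b / fact b)"
    using insert assms(2) unfolding y_def b_def by (intro mult_left_mono) auto
  \<comment> \<open>Up to the factorial, this is a single term of the binomial expansion of
    \<open>(x i + y) ^ (\<alpha> i + b)\<close>.\<close>
  also have "\<dots> = (\<alpha> i + b choose \<alpha> i) * x i ^ \<alpha> i * y ^ b / fact (\<alpha> i + b)"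
    by (simp add: binomial_fact)
  also have "\<dots> \<le> (x i + y) ^ (\<alpha> i + b) / fact (\<alpha> i + b)"
  proof (rule divide_right_mono)
    have "(\<alpha> i + b choose \<alpha> i) * x i ^ \<alpha> i * y ^ (\<alpha> i + b - \<alpha> i)
       \<le> (\<Sum>k\<le>\<alpha> i + b. (\<alpha> i + b choose k) * x i ^ k * y ^ (\<alpha> i + b - k))"
      using assms(2) y by (intro member_le_sum) auto
    then show "(\<alpha> i + b choose \<alpha> i) * x i ^ \<alpha> i * y ^ b \<le> (x i + y) ^ (\<alpha> i + b)"
      by (simp add: binomial_ring)
  qed simp
  finally show ?case using insert by (simp add: y_def b_def)
qed simp

definition gaf_coeff :: "real \<Rightarrow> ('n::finite \<Rightarrow> nat) \<Rightarrow> real" where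
  "gaf_coeff L \<alpha> = sqrt (Gamma (L + real (mi_size \<alpha>)) / (mi_fact \<alpha> * Gamma L))"

lemma mi_fact_pos: "mi_fact \<alpha> > 0"
  unfolding mi_fact_def by (intro prod_pos) auto

lemma gaf_coeff_sq:
  assumes "L > 0"
  shows "(gaf_coeff L \<alpha>)\<^sup>2 = pochhammer L (mi_size \<alpha>) / mi_fact \<alpha>"
proof -
  have "L \<notin> \<int>\<^sub>\<le>\<^sub>0" using assms by (auto elim!: nonpos_Ints_cases)
  then have "pochhammer L (mi_size \<alpha>) = Gamma (L + real (mi_size \<alpha>)) / Gamma L"
    by (rule pochhammer_Gamma)
  then show ?thesis
    using assms mi_fact_pos[of \<alpha>] by (simp add: gaf_coeff_def less_imp_le)
qed

lemma gaf_coeff_pos: "L > 0 \<Longrightarrow> gaf_coeff L \<alpha> > 0"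
  using mi_fact_pos[of \<alpha>] by (simp add: gaf_coeff_def add_pos_nonneg)

text \<open>All terms of the binomial series of \<open>(1 - s) powr (- L)\<close> are nonnegative,
  so each is at most the sum.\<close>

lemma pochhammer_le_powr:
  assumes "L > 0" "0 \<le> (s::real)" "s < 1"
  shows "pochhammer L k / fact k * s ^ k \<le> (1 - s) powr (- L)"
proof -
  have eq: "((-L) gchoose n) * (- s) ^ n = pochhammer L n / fact n * s ^ n" for n
    by (cases "even n") (simp_all add: gbinomial_pochhammer)
  have "(\<lambda>n. pochhammer L n / fact n * s ^ n) sums (1 - s) powr (- L)"
    using gen_binomial_real[of "- s" "- L"] assms unfolding eq by simp
  then show ?thesis
    using sum_le_suminf[of "\<lambda>n. pochhammer L n / fact n * s ^ n" "{k}"] assms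
    by (auto simp: sums_iff pochhammer_nonneg)
qed

text \<open>The multinomial bound with \<open>x i = (norm (z $ i))\<^sup>2\<close>, whose sum is the
  squared norm; it reduces the estimates to the single number
  \<open>mi_size \<alpha>\<close>.\<close>

lemma norm_mi_power_sq_le:
  "(norm (mi_power z \<alpha>))\<^sup>2 / mi_fact \<alpha> \<le> (norm z)\<^sup>2 ^ mi_size \<alpha> / fact (mi_size \<alpha>)"
proof -
  have "(norm (mi_power z \<alpha>))\<^sup>2 / mi_fact \<alpha> = (\<Prod>i\<in>UNIV. ((norm (z $ i))\<^sup>2) ^ \<alpha> i / fact (\<alpha> i))"
    unfolding mi_power_def mi_fact_def prod_norm[symmetric] prod_power_distrib prod_dividef[symmetric]
    by (simp add: norm_power power_power_commute[where n = 2])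
  also have "\<dots> \<le> (\<Sum>i\<in>UNIV. (norm (z $ i))\<^sup>2) ^ mi_size \<alpha> / fact (mi_size \<alpha>)"
    unfolding mi_size_def by (rule multinomial_term_le) auto
  also have "(\<Sum>i\<in>UNIV. (norm (z $ i))\<^sup>2) = (norm z)\<^sup>2"
    by (simp add: norm_vec_def L2_set_def sum_nonneg)
  finally show ?thesis .
qed

lemma gaf_term_le:
  assumes "L > 0" "0 < r" "r < 1" "norm z \<le> r"
  shows "gaf_coeff L \<alpha> * norm (mi_power z \<alpha>) \<le> sqrt r ^ mi_size \<alpha> * (1 - r) powr (- L / 2)"
proof (rule power2_le_imp_le)
  let ?k = "mi_size \<alpha>"
  have "(gaf_coeff L \<alpha> * norm (mi_power z \<alpha>))\<^sup>2
      = pochhammer L ?k * ((norm (mi_power z \<alpha>))\<^sup>2 / mi_fact \<alpha>)"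
    using assms by (simp add: power_mult_distrib gaf_coeff_sq)
  also have "\<dots> \<le> pochhammer L ?k * ((norm z)\<^sup>2 ^ ?k / fact ?k)"
    using assms by (intro mult_left_mono norm_mi_power_sq_le pochhammer_nonneg) auto
  also have "\<dots> \<le> pochhammer L ?k * ((r\<^sup>2) ^ ?k / fact ?k)"
    using assms by (intro mult_left_mono divide_right_mono power_mono pochhammer_nonneg) auto
  \<comment> \<open>One factor \<open>r\<close> of \<open>r\<^sup>2\<close> goes into the binomial
    series; the other is kept as geometric decay in \<open>mi_size \<alpha>\<close>.\<close>
  also have "\<dots> = r ^ ?k * (pochhammer L ?k / fact ?k * r ^ ?k)"
    by (simp add: power2_eq_square power_mult_distrib[of r r])
  also have "\<dots> \<le> r ^ ?k * (1 - r) powr (- L)"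
    using assms by (intro mult_left_mono pochhammer_le_powr) auto
  also have "\<dots> = (sqrt r ^ ?k * (1 - r) powr (- L / 2))\<^sup>2"
  proof -
    have "((1 - r) powr (- L / 2))\<^sup>2 = (1 - r) powr (- L)"
      by (simp add: power2_eq_square flip: powr_add)
    moreover have "(sqrt r ^ ?k)\<^sup>2 = r ^ ?k"
      using assms by (simp add: power_power_commute[where n = 2])
    ultimately show ?thesis by (simp add: power_mult_distrib)
  qed
  finally show "(gaf_coeff L \<alpha> * norm (mi_power z \<alpha>))\<^sup>2 \<le> (sqrt r ^ ?k * (1 - r) powr (- L / 2))\<^sup>2" .
qed (use assms in auto)

lemma mi_fact_le: "mi_fact \<alpha> \<le> real (mi_size \<alpha>) ^ mi_size \<alpha>"
proof -
  have "mi_fact \<alpha> \<le> (\<Prod>i\<in>UNIV. real (mi_size \<alpha>) ^ \<alpha> i)"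
    unfolding mi_fact_def
  proof (intro prod_mono conjI)
    fix i
    have "fact (\<alpha> i) \<le> real (\<alpha> i) ^ \<alpha> i" 
      using fact_le_power[of "\<alpha> i", where 'a = real] by simp
    also have "\<dots> \<le> real (mi_size \<alpha>) ^ \<alpha> i"
      by (intro power_mono of_nat_mono le_mi_size) auto
    finally show "fact (\<alpha> i) \<le> real (mi_size \<alpha>) ^ \<alpha> i" .
  qed auto
  then show ?thesis by (simp add: mi_size_def power_sum)
qed

lemma power_le_pochhammer: "L > 0 \<Longrightarrow> (L::real) ^ k \<le> pochhammer L k"
proof (induction k)
  case (Suc k)
  then have "L ^ k * L \<le> pochhammer L k * (L + k)"
    by (intro mult_mono pochhammer_nonneg) auto
  then show ?case by (simp add: pochhammer_Suc mult_ac)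
qed simp

text \<open>With k = \<open>mi_size \<alpha>\<close>, the bounds
  \<open>L ^ k \<le> pochhammer L k\<close> and \<open>mi_fact \<alpha> \<le> k ^ k\<close> reduce
  the claim to \<open>(\<rho>\<^sup>2 * L / k) ^ k \<ge> 3 ^ k\<close>. The case k = 0 is separate
  because of the division by k.\<close>

lemma gaf_coeff_lower:
  assumes "L > 0" "0 < \<rho>" "3 * real (mi_size \<alpha>) \<le> \<rho>\<^sup>2 * L"
  shows "exp (mi_size \<alpha>) \<le> (gaf_coeff L \<alpha> * \<rho> ^ mi_size \<alpha>)\<^sup>2"
proof (cases "mi_size \<alpha> = 0")
  case True
  then have "mi_fact \<alpha> = 1" by (auto simp: mi_size_def mi_fact_def)
  then show ?thesis using True assms by (simp add: gaf_coeff_sq)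
next
  case False
  let ?k = "mi_size \<alpha>"
  have "exp (real ?k) = exp 1 ^ ?k" by (simp flip: exp_of_nat_mult)
  also have "\<dots> \<le> 3 ^ ?k" using exp_le by (intro power_mono) auto
  also have "\<dots> \<le> (\<rho>\<^sup>2 * L / ?k) ^ ?k"
    using assms False by (intro power_mono) (auto simp: field_simps)
  also have "\<dots> = (\<rho>\<^sup>2) ^ ?k * (L ^ ?k / real ?k ^ ?k)"
    by (simp add: power_divide power_mult_distrib)
  also have "\<dots> \<le> (\<rho>\<^sup>2) ^ ?k * (pochhammer L ?k / mi_fact \<alpha>)"
    using assms False
    by (intro mult_left_mono frac_le power_le_pochhammer mi_fact_le mi_fact_pos pochhammer_nonneg) auto
  also have "\<dots> = (gaf_coeff L \<alpha> * \<rho> ^ ?k)\<^sup>2"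
    using assms by (simp add: power_mult_distrib gaf_coeff_sq power_power_commute[where n = 2])
  finally show ?thesis .
qed

section \<open>Weights that separate the multi-indices of a box\<close>

lemma digits_inj:
  fixes f g :: "nat \<Rightarrow> nat"
  assumes "\<And>i. i < n \<Longrightarrow> f i < B" "\<And>i. i < n \<Longrightarrow> g i < B"
    and "(\<Sum>i<n. f i * B ^ i) = (\<Sum>i<n. g i * B ^ i)" "i < n"
  shows "f i = g i"
  using assms
proof (induction n arbitrary: f g i)
  case (Suc n)
  have *: "(\<Sum>i<Suc n. h i * B ^ i) = h 0 + B * (\<Sum>i<n. h (Suc i) * B ^ i)" for h
    by (simp only: sum.lessThan_Suc_shift) (simp add: sum_distrib_left mult_ac)
  have eq: "f 0 + B * (\<Sum>i<n. f (Suc i) * B ^ i) = g 0 + B * (\<Sum>i<n. g (Suc i) * B ^ i)"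
    using Suc.prems(3) unfolding * .
  have B: "f 0 < B" "g 0 < B" using Suc.prems by auto
  \<comment> \<open>The lowest digit is recovered modulo \<open>B\<close>; cancelling it and the
    factor \<open>B\<close> leaves an expansion with one digit fewer.\<close>
  have 0: "f 0 = g 0" using arg_cong[OF eq, of "\<lambda>x. x mod B"] B by simp
  with eq B have "(\<Sum>i<n. f (Suc i) * B ^ i) = (\<Sum>i<n. g (Suc i) * B ^ i)" by simp
  then have "f (Suc i) = g (Suc i)" if "i < n" for i
    using Suc.IH[of "\<lambda>i. f (Suc i)" "\<lambda>i. g (Suc i)" i] Suc.prems(1,2) that by auto
  with 0 Suc.prems(4) show ?case by (cases i) auto
qed simp

text \<open>The weights are the powers of \<open>B\<close> along an enumeration of the index type,
  so a multi-index of the box is a digit expansion in base \<open>B\<close>. No two of them then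
  share a Taylor degree on the curve, and the last bound keeps these degrees polynomial in
  \<open>B\<close>.\<close>

lemma ex_digit_weights:
  assumes "B \<ge> 1"
  shows "\<exists>d :: 'n::finite \<Rightarrow> nat. (\<forall>i. d i \<ge> 1) \<and>
    inj_on (\<lambda>\<alpha>. \<Sum>i\<in>UNIV. \<alpha> i * d i) (Pi\<^sub>E UNIV (\<lambda>_. {..<B})) \<and>
    (\<forall>\<alpha>\<in>Pi\<^sub>E UNIV (\<lambda>_. {..<B}). (\<Sum>i\<in>UNIV. \<alpha> i * d i) < B ^ CARD('n))"
proof -
  obtain e :: "'n \<Rightarrow> nat" where e: "bij_betw e UNIV {0..<CARD('n)}"
    using ex_bij_betw_finite_nat[of "UNIV :: 'n set"] by auto
  define d where "d = (\<lambda>i. B ^ e i)"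
  define e' where "e' = inv_into UNIV e"
  have e': "e' (e i) = i" for i
    unfolding e'_def using e by (simp add: bij_betw_def)
  have sum: "(\<Sum>i\<in>UNIV. \<alpha> i * d i) = (\<Sum>i<CARD('n). \<alpha> (e' i) * B ^ i)" for \<alpha> :: "'n \<Rightarrow> nat"
    unfolding d_def atLeast0LessThan[symmetric]
    by (subst sum.reindex_bij_betw[OF e, symmetric]) (simp add: e')
  have "inj_on (\<lambda>\<alpha>. \<Sum>i\<in>UNIV. \<alpha> i * d i) (Pi\<^sub>E UNIV (\<lambda>_. {..<B}))"
  proof (rule inj_onI, rule ext)
    fix \<alpha> \<beta> i
    assume *: "\<alpha> \<in> Pi\<^sub>E UNIV (\<lambda>_. {..<B})" "\<beta> \<in> Pi\<^sub>E UNIV (\<lambda>_. {..<B})"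
      "(\<Sum>i\<in>UNIV. \<alpha> i * d i) = (\<Sum>i\<in>UNIV. \<beta> i * d i)"
    have "e i < CARD('n)" using e by (auto simp: bij_betw_def)
    then have "\<alpha> (e' (e i)) = \<beta> (e' (e i))"
      using * unfolding sum by (intro digits_inj[of "CARD('n)" "\<lambda>i. \<alpha> (e' i)" B "\<lambda>i. \<beta> (e' i)"]) auto
    then show "\<alpha> i = \<beta> i" by (simp add: e')
  qed
  moreover have "(\<Sum>i<n. f i * B ^ i) < B ^ n" if "\<And>i. f i < B" for f :: "nat \<Rightarrow> nat" and n
  proof (induction n)
    case (Suc n)
    have "(\<Sum>i<Suc n. f i * B ^ i) < B ^ n + f n * B ^ n" using Suc by simp
    also have "\<dots> = (f n + 1) * B ^ n" by simp
    also have "\<dots> \<le> B * B ^ n" using that[of n] by (intro mult_right_mono) auto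
    finally show ?case by simp
  qed simp
  then have "\<forall>\<alpha>\<in>Pi\<^sub>E UNIV (\<lambda>_. {..<B}). (\<Sum>i\<in>UNIV. \<alpha> i * d i) < B ^ CARD('n)"
    unfolding sum by (auto simp: PiE_iff)
  ultimately show ?thesis using assms by (intro exI[of _ d]) (auto simp: d_def)
qed

subsection \<open>Complex Gaussians\<close>

context prob_space
begin

lemma standard_complex_gaussian_measurable:
  assumes "standard_complex_gaussian M X"
  shows "X \<in> borel_measurable M"
  using assms distributed_measurable[of M lborel X] unfolding standard_complex_gaussian_def by auto

lemma standard_complex_gaussian_emeasure:
  assumes "standard_complex_gaussian M X" "A \<in> sets borel"
  shows "emeasure M (X -` A \<inter> space M) =
    (\<integral>\<^sup>+z. ennreal (exp (- (cmod z)\<^sup>2) / pi) * indicator A z \<partial>lborel)"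
  using assms unfolding standard_complex_gaussian_def by (intro distributed_emeasure) auto

lemma emeasure_lborel_cball_complex:
  assumes "t \<ge> 0"
  shows "emeasure lborel (cball (c::complex) t) = ennreal (pi * t\<^sup>2)"
  using emeasure_cball[OF assms, of c] assms by (simp add: unit_ball_vol_2)

text \<open>The density is at most \<open>1 / pi\<close> and the disc has area
  \<open>pi * t\<^sup>2\<close>. Uniformity in the centre \<open>h\<close> matters, since the centre
  will depend on the other Gaussians.\<close>

lemma gaussian_prob_cball_le:
  assumes "standard_complex_gaussian M X" "t \<ge> 0"
  shows "prob (X -` cball h t \<inter> space M) \<le> t\<^sup>2"
proof -
  have "emeasure M (X -` cball h t \<inter> space M)
     = (\<integral>\<^sup>+z. ennreal (exp (- (cmod z)\<^sup>2) / pi) * indicator (cball h t) z \<partial>lborel)"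
    by (rule standard_complex_gaussian_emeasure[OF assms(1)]) auto
  also have "\<dots> \<le> (\<integral>\<^sup>+z. ennreal (1 / pi) * indicator (cball h t) z \<partial>lborel)"
    by (intro nn_integral_mono mult_right_mono ennreal_leI divide_right_mono) auto
  also have "\<dots> = ennreal (1 / pi) * emeasure lborel (cball h t)"
    by (rule nn_integral_cmult_indicator) auto
  also have "\<dots> = ennreal (t\<^sup>2)"
    using assms(2) by (simp add: emeasure_lborel_cball_complex flip: ennreal_mult)
  finally show ?thesis
    by (simp add: emeasure_eq_measure)
qed

text \<open>On the unit disc the density is at least \<open>1 / (exp 1 * pi)\<close>.\<close>

lemma gaussian_prob_cball_ge:
  assumes "standard_complex_gaussian M X" "0 \<le> t" "t \<le> 1"
  shows "t\<^sup>2 / exp 1 \<le> prob (X -` cball 0 t \<inter> space M)"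
proof -
  have "ennreal (t\<^sup>2 / exp 1) = ennreal (1 / (exp 1 * pi)) * emeasure lborel (cball (0::complex) t)"
    using assms(2) by (simp add: emeasure_lborel_cball_complex flip: ennreal_mult)
  also have "\<dots> = (\<integral>\<^sup>+z. ennreal (1 / (exp 1 * pi)) * indicator (cball (0::complex) t) z \<partial>lborel)"
    by (rule nn_integral_cmult_indicator[symmetric]) auto
  also have "\<dots> \<le> (\<integral>\<^sup>+z. ennreal (exp (- (cmod z)\<^sup>2) / pi) * indicator (cball 0 t) z \<partial>lborel)"
  proof (intro nn_integral_mono)
    fix z :: complex
    show "ennreal (1 / (exp 1 * pi)) * indicator (cball 0 t) z
      \<le> ennreal (exp (- (cmod z)\<^sup>2) / pi) * indicator (cball 0 t) z"
    proof (cases "z \<in> cball 0 t")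
      case True
      then have "cmod z \<le> 1" using assms by auto
      then have "(cmod z)\<^sup>2 \<le> 1" by (simp add: power_le_one)
      then have "1 / exp 1 \<le> exp (- (cmod z)\<^sup>2)"
        by (simp add: exp_minus field_simps)
      then have "1 / exp 1 / pi \<le> exp (- (cmod z)\<^sup>2) / pi" by (intro divide_right_mono) auto
      then show ?thesis using True by (simp add: ennreal_leI)
    qed simp
  qed
  also have "\<dots> = emeasure M (X -` cball 0 t \<inter> space M)"
    by (rule standard_complex_gaussian_emeasure[OF assms(1), symmetric]) auto
  finally show ?thesis
    by (simp add: emeasure_eq_measure)
qed

text \<open>Half of the exponent is traded for the total mass of a Gaussian of variance \<open>2\<close>.\<close>

lemma gaussian_tail_le:
  assumes X: "standard_complex_gaussian M X" and "t \<ge> 0"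
  shows "prob (X -` (- cball 0 t) \<inter> space M) \<le> 2 * exp (- t\<^sup>2 / 2)"
proof -
  let ?g = "\<lambda>z::complex. ennreal (exp (- (cmod z)\<^sup>2 / 2) / pi)"
  have "emeasure M (X -` UNIV \<inter> space M) = (\<integral>\<^sup>+z. ennreal (exp (- (cmod z)\<^sup>2) / pi) * indicator UNIV z \<partial>lborel)"
    by (rule standard_complex_gaussian_emeasure[OF X]) auto
  then have one: "(\<integral>\<^sup>+z. ennreal (exp (- (cmod z)\<^sup>2) / pi) \<partial>lborel) = 1"
    using emeasure_space_1 by simp
  \<comment> \<open>The change of variables by the factor \<open>sqrt 2\<close> has Jacobian 2 on
    the plane and turns \<open>?g\<close> into the standard density.\<close>
  have "(\<integral>\<^sup>+z. ?g z \<partial>lborel) = (\<integral>\<^sup>+z. ?g z \<partial>density (distr lborel borel (\<lambda>x. 0 + sqrt 2 *\<^sub>R x)) (\<lambda>_. \<bar>sqrt 2\<bar> ^ DIM(complex)))"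
    by (subst lborel_affine[of "sqrt 2" 0]) auto
  also have "\<dots> = (\<integral>\<^sup>+z. 2 * ?g (sqrt 2 *\<^sub>R z) \<partial>lborel)"
    by (subst nn_integral_density) (auto simp: nn_integral_distr)
  also have "\<dots> = (\<integral>\<^sup>+z. 2 * ennreal (exp (- (cmod z)\<^sup>2) / pi) \<partial>lborel)"
    by (simp add: power_mult_distrib)
  also have "\<dots> = 2"
    using one by (subst nn_integral_cmult) auto
  finally have two: "(\<integral>\<^sup>+z. ?g z \<partial>lborel) = 2" .
  have "emeasure M (X -` (- cball 0 t) \<inter> space M)
     = (\<integral>\<^sup>+z. ennreal (exp (- (cmod z)\<^sup>2) / pi) * indicator (- cball 0 t) z \<partial>lborel)"
    by (rule standard_complex_gaussian_emeasure[OF X]) auto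
  also have "\<dots> \<le> (\<integral>\<^sup>+z. ennreal (exp (- t\<^sup>2 / 2)) * ?g z \<partial>lborel)"
  proof (intro nn_integral_mono)
    fix z :: complex
    show "ennreal (exp (- (cmod z)\<^sup>2) / pi) * indicator (- cball 0 t) z
      \<le> ennreal (exp (- t\<^sup>2 / 2)) * ?g z"
    proof (cases "z \<in> cball 0 t")
      case False
      then have "t\<^sup>2 \<le> (cmod z)\<^sup>2" using assms by (intro power_mono) auto
      then have "exp (- (cmod z)\<^sup>2) \<le> exp (- t\<^sup>2 / 2) * exp (- (cmod z)\<^sup>2 / 2)"
        by (simp flip: exp_add)
      then have "exp (- (cmod z)\<^sup>2) / pi \<le> exp (- t\<^sup>2 / 2) * (exp (- (cmod z)\<^sup>2 / 2) / pi)"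
        by (simp add: divide_right_mono)
      then show ?thesis using False by (simp add: ennreal_leI flip: ennreal_mult)
    qed simp
  qed
  also have "\<dots> = ennreal (exp (- t\<^sup>2 / 2)) * 2"
    using two by (subst nn_integral_cmult) auto
  also have "\<dots> = ennreal (2 * exp (- t\<^sup>2 / 2))"
    by (simp add: mult.commute ennreal_mult)
  finally show ?thesis
    by (simp add: emeasure_eq_measure)
qed

text \<open>Fubini: with \<open>Y\<close> frozen, \<open>p (X \<omega>)\<close> has to hit a disc of
  radius \<open>t\<close> with a fixed centre. The map \<open>p\<close> is there because
  \<open>X\<close> will be a family of Gaussians restricted to a single index.\<close>

lemma gaussian_small_ball_indep:
  assumes X: "standard_complex_gaussian M (\<lambda>\<omega>. p (X \<omega>))" and ind: "indep_var S X N Y"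
    and p [measurable]: "p \<in> borel_measurable S"
    and h [measurable]: "h \<in> borel_measurable N" and E [measurable]: "E \<in> sets N" and "t \<ge> 0"
  shows "prob {\<omega>\<in>space M. Y \<omega> \<in> E \<and> cmod (p (X \<omega>) - h (Y \<omega>)) \<le> t}
    \<le> t\<^sup>2 * prob {\<omega>\<in>space M. Y \<omega> \<in> E}"
proof -
  have rv [measurable]: "X \<in> measurable M S" "Y \<in> measurable M N"
    using indep_var_rv1[OF ind] indep_var_rv2[OF ind] by auto
  interpret X: prob_space "distr M S X" by (rule prob_space_distr) simp
  interpret Y: prob_space "distr M N Y" by (rule prob_space_distr) simp
  interpret XY: pair_prob_space "distr M S X" "distr M N Y" ..
  define A where "A = {q \<in> space (S \<Otimes>\<^sub>M N). snd q \<in> E \<and> cmod (p (fst q) - h (snd q)) \<le> t}"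
  have A [measurable]: "A \<in> sets (S \<Otimes>\<^sub>M N)"
    unfolding A_def by measurable
  have A': "A \<in> sets (distr M S X \<Otimes>\<^sub>M distr M N Y)"
    using A by (simp cong: sets_pair_measure_cong)
  have sec: "emeasure (distr M S X) ((\<lambda>x. (x, y)) -` A) \<le> ennreal (t\<^sup>2) * indicator E y"
    if "y \<in> space N" for y
  proof (cases "y \<in> E")
    case True
    have "(\<lambda>x. (x, y)) -` A = p -` cball (h y) t \<inter> space S"
      using True that by (auto simp: A_def space_pair_measure dist_norm norm_minus_commute)
    moreover have "X -` (p -` cball (h y) t \<inter> space S) \<inter> space M = (\<lambda>\<omega>. p (X \<omega>)) -` cball (h y) t \<inter> space M"
      using measurable_space[OF rv(1)] by auto
    ultimately show ?thesis
      using True gaussian_prob_cball_le[OF X \<open>t \<ge> 0\<close>, of "h y"]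
      by (simp add: emeasure_distr emeasure_eq_measure ennreal_leI)
  next
    case False
    then have "(\<lambda>x. (x, y)) -` A = {}" by (auto simp: A_def)
    then show ?thesis by simp
  qed
  have "emeasure M {\<omega>\<in>space M. Y \<omega> \<in> E \<and> cmod (p (X \<omega>) - h (Y \<omega>)) \<le> t}
     = emeasure (distr M (S \<Otimes>\<^sub>M N) (\<lambda>x. (X x, Y x))) A"
    using measurable_space[OF rv(1)] measurable_space[OF rv(2)]
    by (subst emeasure_distr) (auto intro!: arg_cong[where f = "emeasure M"] simp: A_def space_pair_measure)
  also have "\<dots> = emeasure (distr M S X \<Otimes>\<^sub>M distr M N Y) A"
    using ind unfolding indep_var_distribution_eq by simp
  also have "\<dots> = (\<integral>\<^sup>+y. emeasure (distr M S X) ((\<lambda>x. (x, y)) -` A) \<partial>distr M N Y)"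
    by (rule XY.emeasure_pair_measure_alt2[OF A'])
  also have "\<dots> \<le> (\<integral>\<^sup>+y. ennreal (t\<^sup>2) * indicator E y \<partial>distr M N Y)"
    using sec by (intro nn_integral_mono) auto
  also have "\<dots> = ennreal (t\<^sup>2) * emeasure (distr M N Y) E"
    by (subst nn_integral_cmult_indicator) auto
  also have "emeasure (distr M N Y) E = emeasure M {\<omega>\<in>space M. Y \<omega> \<in> E}"
    by (subst emeasure_distr) (auto intro!: arg_cong[where f = "emeasure M"])
  finally show ?thesis
    by (simp add: emeasure_eq_measure flip: ennreal_mult)
qed

text \<open>Independence gives product formulas for finite index sets only; continuity from above
  along an enumeration carries the bound to all indices.\<close>

lemma indep_vars_prob_all_ge:
  fixes a :: "'i::countable \<Rightarrow> 'a \<Rightarrow> complex"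
  assumes ind: "indep_vars (\<lambda>_. borel) a UNIV" and A: "\<And>i. A i \<in> sets borel"
    and ge: "\<And>S. finite S \<Longrightarrow> p \<le> (\<Prod>i\<in>S. prob (a i -` A i \<inter> space M))"
  shows "p \<le> prob {\<omega>\<in>space M. \<forall>i. a i \<omega> \<in> A i}"
proof -
  have [measurable]: "a i \<in> borel_measurable M" for i
    using ind by (auto simp: indep_vars_def)
  define S where "S n = (from_nat ` {..n} :: 'i set)" for n
  define F where "F n = (\<Inter>i\<in>S n. a i -` A i \<inter> space M)" for n
  have F: "F n \<in> events" for n
    unfolding F_def S_def using A by (intro sets.finite_INT) auto
  have "p \<le> prob (F n)" for n
    unfolding F_def using ge[of "S n"] A by (subst indep_varsD[OF ind]) (auto simp: S_def)
  moreover have "(\<lambda>n. prob (F n)) \<longlonglongrightarrow> prob (\<Inter>n. F n)"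
    using F by (intro finite_Lim_measure_decseq) (auto simp: decseq_def F_def S_def)
  moreover have "(\<Inter>n. F n) = {\<omega>\<in>space M. \<forall>i. a i \<omega> \<in> A i}"
  proof -
    have "\<exists>n. i \<in> S n" for i
      by (rule exI[of _ "to_nat i"]) (auto simp: S_def intro!: image_eqI[of _ _ "to_nat i"])
    moreover have "(\<Inter>n. F n) = {\<omega>\<in>space M. \<forall>n. \<forall>i\<in>S n. a i \<omega> \<in> A i}"
      by (force simp: F_def S_def)
    ultimately show ?thesis by blast
  qed
  ultimately show ?thesis by (auto intro: LIMSEQ_le_const)
qed

end

text \<open>The Weierstrass product inequality: it turns small failure probabilities
  \<open>q i\<close> into a lower bound for the probability that no failure occurs.\<close>

lemma prod_ge_one_minus_sum:
  fixes q :: "'i \<Rightarrow> real"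
  assumes "finite S" "\<And>i. i \<in> S \<Longrightarrow> 0 \<le> q i \<and> q i \<le> 1"
  shows "1 - (\<Sum>i\<in>S. q i) \<le> (\<Prod>i\<in>S. 1 - q i)"
  using assms
proof induction
  case (insert i S)
  have "(\<Prod>i\<in>S. 1 - q i) \<le> 1" using insert by (intro prod_le_1) auto
  then have "q i * (\<Prod>i\<in>S. 1 - q i) \<le> q i * 1" using insert by (intro mult_left_mono) auto
  then show ?case using insert by (simp add: algebra_simps)
qed simp

subsection \<open>Measurability of the hole event\<close>

lemma infinite_multi_indices: "infinite (UNIV :: ('n::finite \<Rightarrow> nat) set)"
proof
  assume "finite (UNIV :: ('n \<Rightarrow> nat) set)"
  then have "finite (range (\<lambda>k (_::'n). k :: nat))" by (rule rev_finite_subset) simp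
  then show False
    by (auto simp: finite_image_iff inj_on_def fun_eq_iff)
qed

lemma norm_mi_power_mono:
  "(\<And>i. norm (z $ i) \<le> norm (w $ i)) \<Longrightarrow> norm (mi_power z \<alpha>) \<le> norm (mi_power w \<alpha>)"
  unfolding mi_power_def prod_norm[symmetric] norm_power by (intro prod_mono conjI power_mono) auto

lemma open_componentwise_less:
  "open {z :: complex ^ 'n::finite. \<forall>i. norm (z $ i) < norm (w $ i)}"
proof -
  have "{z :: complex ^ 'n. \<forall>i. norm (z $ i) < norm (w $ i)} =
    (\<Inter>i. {z. norm (z $ i) < norm (w $ i)})" by auto
  also have "open \<dots>"
    by (intro open_INT open_Collect_less continuous_intros ballI) auto
  finally show ?thesis .
qed

text \<open>Adding a small \<eta> to all moduli yields a point of the open set \<open>V\<close>, so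
  \<open>V\<close> meets the dense set \<open>D\<close>. Absolute convergence of a power series at
  the dominating point implies absolute convergence near \<open>z\<close>.\<close>

lemma ex_dominating_point:
  fixes z :: "complex ^ 'n::finite"
  assumes dense: "\<And>X :: (complex ^ 'n) set. open X \<Longrightarrow> X \<noteq> {} \<Longrightarrow> \<exists>d\<in>D. d \<in> X"
    and "norm z < r"
  shows "\<exists>w\<in>D \<inter> ball 0 r. \<forall>i. norm (z $ i) < norm (w $ i)"
proof -
  define V where "V = ball 0 r \<inter> (\<Inter>i. {w :: complex ^ 'n. norm (z $ i) < norm (w $ i)})"
  have "open V" unfolding V_def
    by (intro open_Int open_INT open_Collect_less continuous_intros ballI) auto
  define \<eta> where "\<eta> = (r - norm z) / (2 * CARD('n))"
  have \<eta>: "\<eta> > 0" using assms by (simp add: \<eta>_def)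
  define w :: "complex ^ 'n" where "w = (\<chi> i. complex_of_real (norm (z $ i) + \<eta>))"
  have nw: "norm (w $ i) = norm (z $ i) + \<eta>" for i
    using \<eta> by (simp add: w_def del: of_real_add)
  have "norm w = L2_set (\<lambda>i. norm (z $ i) + \<eta>) UNIV"
    unfolding norm_vec_def nw ..
  also have "\<dots> \<le> L2_set (\<lambda>i. norm (z $ i)) UNIV + L2_set (\<lambda>i. \<eta>) (UNIV :: 'n set)"
    by (rule L2_set_triangle_ineq)
  also have "L2_set (\<lambda>i. \<eta>) (UNIV :: 'n set) \<le> (\<Sum>i\<in>(UNIV :: 'n set). \<eta>)"
    using \<eta> by (intro L2_set_le_sum) auto
  also have "(\<Sum>i\<in>(UNIV :: 'n set). \<eta>) = (r - norm z) / 2"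
    by (simp add: \<eta>_def)
  finally have "norm w < r" using assms(2) unfolding norm_vec_def by (simp add: field_simps)
  then have "w \<in> V" unfolding V_def using nw \<eta> by auto
  with \<open>open V\<close> obtain d where "d \<in> D" "d \<in> V" using dense[of V] by blast
  then show ?thesis by (auto simp: V_def)
qed

lemma multi_index_enumeration:
  obtains b :: "nat \<Rightarrow> 'n::finite \<Rightarrow> nat" where "bij b"
  using bij_betw_from_nat_into[OF _ infinite_multi_indices, where 'n1 = 'n] by auto

text \<open>Unordered summability of complex numbers is absolute summability, so an enumeration
  computes the sum. This replaces \<open>infsum\<close> by sequential sums, which preserve
  measurability.\<close>

lemma mi_series_enum:
  fixes f :: "('n::finite \<Rightarrow> nat) \<Rightarrow> complex"
  assumes "bij b"
  shows "f summable_on UNIV \<longleftrightarrow> summable (\<lambda>k. norm (f (b k)))"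
    and "f summable_on UNIV \<Longrightarrow> infsum f UNIV = (\<Sum>k. f (b k))"
proof -
  have "f summable_on UNIV \<longleftrightarrow> (\<lambda>k. norm (f (b k))) summable_on UNIV"
    unfolding summable_on_iff_abs_summable_on_complex
    using summable_on_reindex_bij_betw[OF assms, of "\<lambda>\<alpha>. norm (f \<alpha>)"] by simp
  then show "f summable_on UNIV \<longleftrightarrow> summable (\<lambda>k. norm (f (b k)))"
    by (simp add: summable_on_UNIV_nonneg_real_iff)
  assume "f summable_on UNIV"
  then have "((\<lambda>k. f (b k)) has_sum infsum f UNIV) UNIV"
    by (simp add: has_sum_reindex_bij_betw[OF assms])
  then show "infsum f UNIV = (\<Sum>k. f (b k))"
    using has_sum_imp_sums sums_unique by blast
qed

text \<open>Weierstrass M-test on the open polydisc below a dominating point \<open>w\<close>, with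
  the absolutely convergent series at \<open>w\<close> as majorant.\<close>

lemma continuous_on_mi_series:
  fixes c :: "('n::finite \<Rightarrow> nat) \<Rightarrow> complex"
  assumes summ: "\<And>z. z \<in> ball 0 r \<Longrightarrow> (\<lambda>\<alpha>. c \<alpha> * mi_power z \<alpha>) summable_on UNIV"
  shows "continuous_on (ball 0 r) (\<lambda>z. \<Sum>\<^sub>\<infinity>\<alpha>. c \<alpha> * mi_power z \<alpha>)"
proof (intro continuous_at_imp_continuous_on ballI)
  fix z :: "complex ^ 'n" assume "z \<in> ball 0 r"
  then obtain w :: "complex ^ 'n" where w: "norm w < r" "\<And>i. norm (z $ i) < norm (w $ i)"
    using ex_dominating_point[of UNIV z r] by (auto simp: ex_in_conv)
  obtain b :: "nat \<Rightarrow> 'n \<Rightarrow> nat" where b: "bij b" by (rule multi_index_enumeration)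
  define V where "V = {z :: complex ^ 'n. \<forall>i. norm (z $ i) < norm (w $ i)}"
  have V: "open V" unfolding V_def by (rule open_componentwise_less)
  have zV: "z \<in> V" using w by (simp add: V_def)
  have le: "norm (c (b k) * mi_power y (b k)) \<le> norm (c (b k) * mi_power w (b k))" if "y \<in> V" for k y
    unfolding norm_mult using that
    by (intro mult_left_mono norm_mi_power_mono) (auto simp: V_def less_imp_le)
  have sw: "summable (\<lambda>k. norm (c (b k) * mi_power w (b k)))"
    using summ[of w] w(1) mi_series_enum(1)[OF b, of "\<lambda>\<alpha>. c \<alpha> * mi_power w \<alpha>"] by auto
  have u: "uniform_limit V (\<lambda>n y. \<Sum>k<n. c (b k) * mi_power y (b k))
     (\<lambda>y. \<Sum>k. c (b k) * mi_power y (b k)) sequentially"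
    by (rule Weierstrass_m_test[OF le sw])
  have "continuous_on V (\<lambda>y. \<Sum>k<n. c (b k) * mi_power y (b k))" for n
    unfolding mi_power_def by (intro continuous_intros)
  then have "continuous_on V (\<lambda>y. \<Sum>k. c (b k) * mi_power y (b k))"
    by (intro uniform_limit_theorem[OF _ u]) auto
  also have "?this \<longleftrightarrow> continuous_on V (\<lambda>z. \<Sum>\<^sub>\<infinity>\<alpha>. c \<alpha> * mi_power z \<alpha>)"
  proof (intro continuous_on_cong refl)
    fix y assume "y \<in> V"
    then have "summable (\<lambda>k. norm (c (b k) * mi_power y (b k)))"
      using le by (intro summable_comparison_test'[OF sw, of 0]) simp
    then show "(\<Sum>k. c (b k) * mi_power y (b k)) = (\<Sum>\<^sub>\<infinity>\<alpha>. c \<alpha> * mi_power y \<alpha>)"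
      using mi_series_enum[OF b, of "\<lambda>\<alpha>. c \<alpha> * mi_power y \<alpha>"] by simp
  qed
  finally show "isCont (\<lambda>z. \<Sum>\<^sub>\<infinity>\<alpha>. c \<alpha> * mi_power z \<alpha>) z"
    using V zV continuous_on_eq_continuous_at by blast
qed

text \<open>By compactness a zero-free continuous function is bounded away from 0 on each smaller
  closed ball; conversely, near a zero the modulus is small, hence also at a point of
  \<open>D\<close>. For countable \<open>D\<close> the right-hand side is a countable
  condition.\<close>

lemma nonvanishing_on_ball_iff:
  fixes F :: "'a::euclidean_space \<Rightarrow> complex"
  assumes cont: "continuous_on (ball 0 r) F" and "r > 0"
    and dense: "\<And>X :: 'a set. open X \<Longrightarrow> X \<noteq> {} \<Longrightarrow> \<exists>d\<in>D. d \<in> X"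
  shows "(\<forall>z\<in>ball 0 r. F z \<noteq> 0) \<longleftrightarrow>
    (\<forall>k. \<exists>m. \<forall>z\<in>D \<inter> ball 0 (r - r / real (k + 2)). 1 / real (m + 1) \<le> norm (F z))"
proof (intro iffI allI ballI)
  fix k :: nat
  assume nz: "\<forall>z\<in>ball 0 r. F z \<noteq> 0"
  define s where "s = r - r / real (k + 2)"
  have s: "0 \<le> s" "s < r" using \<open>r > 0\<close> by (auto simp: s_def field_simps)
  have sub: "cball 0 s \<subseteq> ball (0::'a) r" using s by auto
  have "\<exists>x\<in>cball 0 s. \<forall>y\<in>cball (0::'a) s. norm (F x) \<le> norm (F y)"
    using s by (intro continuous_attains_inf continuous_intros continuous_on_subset[OF cont sub]) auto
  then obtain x where x: "x \<in> cball 0 s" "\<And>y. y \<in> cball (0::'a) s \<Longrightarrow> norm (F x) \<le> norm (F y)"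
    by blast
  have "norm (F x) > 0" using nz x(1) sub by auto
  then obtain m where m: "1 / real (Suc m) < norm (F x)"
    using reals_Archimedean by (metis inverse_eq_divide)
  have "1 / real (m + 1) \<le> norm (F z)" if "z \<in> D \<inter> ball 0 s" for z
    using m x(2)[of z] that by auto
  then show "\<exists>m. \<forall>z\<in>D \<inter> ball 0 (r - r / real (k + 2)). 1 / real (m + 1) \<le> norm (F z)"
    unfolding s_def by blast
next
  fix z :: 'a
  assume *: "\<forall>k. \<exists>m. \<forall>z\<in>D \<inter> ball 0 (r - r / real (k + 2)). 1 / real (m + 1) \<le> norm (F z)"
    and z: "z \<in> ball 0 r"
  then have "(r - norm z) / r > 0" using \<open>r > 0\<close> by simp
  then obtain k where "1 / real (Suc k) < (r - norm z) / r"
    using reals_Archimedean by (metis inverse_eq_divide)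
  moreover have "1 / real (k + 2) < 1 / real (Suc k)" by (simp add: field_simps)
  ultimately have "1 / real (k + 2) < (r - norm z) / r" by linarith
  then have "r / real (k + 2) < r - norm z"
    using \<open>r > 0\<close> by (simp add: field_simps)
  define s where "s = r - r / real (k + 2)"
  have zs: "z \<in> ball 0 s" and s: "s < r"
    using \<open>r / real (k + 2) < r - norm z\<close> \<open>r > 0\<close> by (auto simp: s_def)
  obtain m where m: "\<And>z. z \<in> D \<inter> ball 0 s \<Longrightarrow> 1 / real (m + 1) \<le> norm (F z)"
    using * unfolding s_def by blast
  show "F z \<noteq> 0"
  proof
    assume "F z = 0"
    define U where "U = {y \<in> ball 0 s. norm (F y) < 1 / real (m + 1)}"
    have "continuous_on (ball 0 s) F"
      by (rule continuous_on_subset[OF cont]) (use s in auto)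
    then have "open (ball 0 s \<inter> F -` ball 0 (1 / real (m + 1)))"
      by (rule continuous_open_preimage) auto
    also have "ball 0 s \<inter> F -` ball 0 (1 / real (m + 1)) = U"
      by (auto simp: U_def)
    finally have "open U" .
    moreover have "z \<in> U" using zs \<open>F z = 0\<close> by (simp add: U_def)
    ultimately obtain d where "d \<in> D" "d \<in> U" using dense by blast
    then show False using m[of d] by (auto simp: U_def)
  qed
qed

text \<open>A non-measurable set has measure \<open>0\<close>, so the lower bound on the hole probability depends on this.\<close>

lemma measurable_nonvanishing:
  fixes c :: "('n::finite \<Rightarrow> nat) \<Rightarrow> 'w \<Rightarrow> complex"
  assumes [measurable]: "\<And>\<alpha>. c \<alpha> \<in> borel_measurable M" and "r > 0"
  shows "{\<omega>\<in>space M. \<forall>z\<in>ball 0 r. (\<Sum>\<^sub>\<infinity>\<alpha>. c \<alpha> \<omega> * mi_power z \<alpha>) \<noteq> 0} \<in> sets M"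
proof -
  obtain b :: "nat \<Rightarrow> 'n \<Rightarrow> nat" where b: "bij b" by (rule multi_index_enumeration)
  obtain D :: "(complex ^ 'n) set" where D: "countable D"
    "\<And>X. open X \<Longrightarrow> X \<noteq> {} \<Longrightarrow> \<exists>d\<in>D. d \<in> X"
    using countable_dense_setE by blast
  let ?f = "\<lambda>z \<omega> \<alpha>. c \<alpha> \<omega> * mi_power z \<alpha>"
  \<comment> \<open>A sum in \<open>ennreal\<close> always exists, so this expresses absolute
    convergence by a measurable condition.\<close>
  let ?S = "\<lambda>z \<omega>. (\<Sum>k. ennreal (norm (?f z \<omega> (b k)))) < top"
  let ?G = "\<lambda>z \<omega>. \<Sum>k. ?f z \<omega> (b k)"
  have S: "?S z \<omega> \<longleftrightarrow> ?f z \<omega> summable_on UNIV" for z \<omega>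
    unfolding mi_series_enum(1)[OF b]
  proof
    assume "?S z \<omega>"
    then show "summable (\<lambda>k. norm (?f z \<omega> (b k)))"
      by (intro summable_suminf_not_top) (rule norm_ge_zero, rule less_imp_neq)
  next
    assume "summable (\<lambda>k. norm (?f z \<omega> (b k)))"
    then have "(\<Sum>k. ennreal (norm (?f z \<omega> (b k)))) \<noteq> top"
      by (rule ennreal_suminf_neq_top) (rule norm_ge_zero)
    then show "?S z \<omega>" unfolding less_top .
  qed
  have iff: "(\<forall>z\<in>ball 0 r. infsum (?f z \<omega>) UNIV \<noteq> 0) \<longleftrightarrow>
     (\<forall>z\<in>D \<inter> ball 0 r. ?S z \<omega>) \<and>
     (\<forall>k. \<exists>m. \<forall>z\<in>D \<inter> ball 0 (r - r / real (k + 2)). 1 / real (m + 1) \<le> norm (?G z \<omega>))" for \<omega>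
  proof (cases "\<forall>z\<in>ball 0 r. ?f z \<omega> summable_on UNIV")
    case True
    have G: "infsum (?f z \<omega>) UNIV = ?G z \<omega>" if "z \<in> ball 0 (r - r / real (k + 2))" for k z
    proof (rule mi_series_enum(2)[OF b])
      have "r / real (k + 2) > 0" using \<open>r > 0\<close> by simp
      then have "z \<in> ball 0 r" using that by simp
      then show "?f z \<omega> summable_on UNIV" using True by blast
    qed
    have "(\<forall>z\<in>D \<inter> ball 0 (r - r / real (k + 2)). 1 / real (m + 1) \<le> norm (infsum (?f z \<omega>) UNIV)) \<longleftrightarrow>
        (\<forall>z\<in>D \<inter> ball 0 (r - r / real (k + 2)). 1 / real (m + 1) \<le> norm (?G z \<omega>))" for k m
      by (rule ball_cong[OF refl], subst G[where k = k]) auto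
    moreover have "\<forall>z\<in>D \<inter> ball 0 r. ?S z \<omega>" using True unfolding S by blast
    moreover have "continuous_on (ball 0 r) (\<lambda>z. infsum (?f z \<omega>) UNIV)"
      by (rule continuous_on_mi_series) (use True in blast)
    ultimately show ?thesis
      using nonvanishing_on_ball_iff[OF _ \<open>r > 0\<close> D(2), of "\<lambda>z. infsum (?f z \<omega>) UNIV"]
      by presburger
  next
    \<comment> \<open>Both sides fail: at \<open>z\<close> the sum has the default value 0, and the
      series cannot converge absolutely at a point \<open>w\<close> of \<open>D\<close> that
      dominates \<open>z\<close>.\<close>
    case False
    then obtain z where z: "z \<in> ball 0 r" "\<not> ?f z \<omega> summable_on UNIV" by auto
    then obtain w where w: "w \<in> D \<inter> ball 0 r" "\<And>i. norm (z $ i) < norm (w $ i)"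
      using ex_dominating_point[OF D(2), of z r] by auto
    have "\<not> ?f w \<omega> summable_on UNIV"
    proof
      assume "?f w \<omega> summable_on UNIV"
      then have "(\<lambda>\<alpha>. norm (?f z \<omega> \<alpha>)) summable_on UNIV"
        unfolding summable_on_iff_abs_summable_on_complex
        by (rule Infinite_Sum.abs_summable_on_comparison_test)
           (auto simp: norm_mult w(2) less_imp_le intro!: mult_left_mono norm_mi_power_mono)
      then show False using z(2) Infinite_Sum.abs_summable_summable[of "?f z \<omega>" UNIV] by simp
    qed
    then show ?thesis using w(1) z infsum_not_exists[OF z(2)] unfolding S by blast
  qed
  have [measurable]: "(\<lambda>\<omega>. ?S z \<omega>) \<in> measurable M (count_space UNIV)"
    "(\<lambda>\<omega>. ?G z \<omega>) \<in> borel_measurable M" for z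
    by measurable
  have cnt: "countable (D \<inter> X)" for X using D(1) by auto
  show ?thesis unfolding iff
    by (intro sets.sets_Collect_conj sets.sets_Collect_countable_All sets.sets_Collect_countable_Ex
        sets.sets_Collect_countable_All' cnt) measurable
qed

subsection \<open>Growth of the series\<close>

definition gaf_term :: "real \<Rightarrow> (('n::finite \<Rightarrow> nat) \<Rightarrow> complex) \<Rightarrow> complex ^ 'n \<Rightarrow> ('n \<Rightarrow> nat) \<Rightarrow> complex" where
  "gaf_term L c z \<alpha> = c \<alpha> * of_real (gaf_coeff L \<alpha>) * mi_power z \<alpha>"

lemma hyperbolic_GAF_eq: "hyperbolic_GAF L a \<omega> z = infsum (gaf_term L (\<lambda>\<alpha>. a \<alpha> \<omega>) z) UNIV"
  by (simp add: hyperbolic_GAF_def gaf_term_def[abs_def] gaf_coeff_def)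

text \<open>The radius is written \<open>x ^ 4\<close> because its square root is
  \<open>x * x\<close>: one factor \<open>x ^ mi_size \<alpha>\<close> absorbs the growth of the
  coefficients, the other leaves a summable bound.\<close>

lemma gaf_term_growth:
  fixes c :: "('n::finite \<Rightarrow> nat) \<Rightarrow> complex"
  assumes L: "L > 0" and x: "0 < x" "x < 1"
    and c: "norm (c \<alpha>) * x ^ mi_size \<alpha> \<le> T" and z: "norm z \<le> x ^ 4"
  shows "norm (gaf_term L c z \<alpha>) \<le> T * (1 - x ^ 4) powr (- L / 2) * x ^ mi_size \<alpha>"
proof -
  let ?k = "mi_size \<alpha>"
  have r: "0 < x ^ 4" "x ^ 4 < 1" using x by (auto simp: power_less_one_iff)
  have "sqrt (x ^ 4) = x ^ 2" using x by (intro real_sqrt_unique) auto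
  then have sq: "sqrt (x ^ 4) ^ ?k = x ^ ?k * x ^ ?k"
    by (simp add: power2_eq_square power_mult_distrib)
  have "norm (gaf_term L c z \<alpha>) = norm (c \<alpha>) * (gaf_coeff L \<alpha> * norm (mi_power z \<alpha>))"
    using gaf_coeff_pos[OF L, of \<alpha>] by (simp add: gaf_term_def norm_mult)
  also have "\<dots> \<le> norm (c \<alpha>) * (sqrt (x ^ 4) ^ ?k * (1 - x ^ 4) powr (- L / 2))"
    by (intro mult_left_mono gaf_term_le L r z) auto
  also have "\<dots> = (norm (c \<alpha>) * x ^ ?k) * ((1 - x ^ 4) powr (- L / 2) * x ^ ?k)"
    unfolding sq by simp
  also have "\<dots> \<le> T * ((1 - x ^ 4) powr (- L / 2) * x ^ ?k)"
    using x by (intro mult_right_mono c) auto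
  finally show ?thesis by simp
qed

lemma gaf_series_growth:
  fixes c :: "('n::finite \<Rightarrow> nat) \<Rightarrow> complex"
  assumes L: "L > 0" and x: "0 < x" "x < 1"
    and c: "\<And>\<alpha>. norm (c \<alpha>) * x ^ mi_size \<alpha> \<le> T" and z: "norm z \<le> x ^ 4"
  shows "gaf_term L c z summable_on UNIV"
    and "norm (infsum (gaf_term L c z) UNIV) \<le> T * (1 - x ^ 4) powr (- L / 2) / (1 - x) ^ CARD('n)"
proof -
  define C where "C = T * (1 - x ^ 4) powr (- L / 2)"
  have "0 \<le> norm (c (\<lambda>_. 0)) * x ^ mi_size (\<lambda>_::'n. 0)" using x by simp
  then have "T \<ge> 0" using c[of "\<lambda>_. 0"] by linarith
  then have C: "C \<ge> 0" by (simp add: C_def)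
  have le: "norm (gaf_term L c z \<alpha>) \<le> C * x ^ mi_size \<alpha>" for \<alpha>
    unfolding C_def by (rule gaf_term_growth) (use assms in auto)
  have s: "(\<lambda>\<alpha> :: 'n \<Rightarrow> nat. C * x ^ mi_size \<alpha>) summable_on UNIV"
    using x by (intro summable_on_cmult_right summable_power_mi_size) auto
  have "(\<lambda>\<alpha>. norm (gaf_term L c z \<alpha>)) summable_on UNIV"
    by (rule summable_on_comparison_test[OF s]) (use le in auto)
  then show summ: "gaf_term L c z summable_on UNIV"
    using Infinite_Sum.abs_summable_summable[of "gaf_term L c z" UNIV] by simp
  have "norm (infsum (gaf_term L c z) UNIV) \<le> (\<Sum>\<^sub>\<infinity>\<alpha> :: 'n \<Rightarrow> nat. C * x ^ mi_size \<alpha>)"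
    by (rule norm_infsum_le[OF has_sum_infsum[OF summ] has_sum_infsum[OF s]]) (use le in auto)
  also have "\<dots> = C * (\<Sum>\<^sub>\<infinity>\<alpha> :: 'n \<Rightarrow> nat. x ^ mi_size \<alpha>)"
    by (rule infsum_cmult_right')
  also have "\<dots> \<le> C * (1 / (1 - x) ^ CARD('n))"
    using x C by (intro mult_left_mono infsum_power_mi_size_le) auto
  finally show "norm (infsum (gaf_term L c z) UNIV) \<le> T * (1 - x ^ 4) powr (- L / 2) / (1 - x) ^ CARD('n)"
    by (simp add: C_def)
qed

text \<open>The growth bound is applied to the coefficients with the constant term erased; by the
  last hypothesis the constant term dominates what remains.\<close>

lemma gaf_nonzero:
  fixes c :: "('n::finite \<Rightarrow> nat) \<Rightarrow> complex"
  assumes L: "L > 0" and x: "0 < x" "x < 1" and "T \<ge> 0"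
    and c: "\<And>\<alpha>. \<alpha> \<noteq> (\<lambda>_. 0) \<Longrightarrow> norm (c \<alpha>) * x ^ mi_size \<alpha> \<le> T" and z: "norm z \<le> x ^ 4"
    and T: "T * (1 - x ^ 4) powr (- L / 2) / (1 - x) ^ CARD('n) < norm (c (\<lambda>_. 0))"
  shows "infsum (gaf_term L c z) UNIV \<noteq> 0"
proof -
  define c' where "c' = c(\<lambda>_. 0 := 0)"
  have "norm (c' \<alpha>) * x ^ mi_size \<alpha> \<le> T" for \<alpha>
    using c[of \<alpha>] \<open>T \<ge> 0\<close> by (auto simp: c'_def)
  note growth = gaf_series_growth[OF L x this z]
  let ?Z = "UNIV - {\<lambda>_::'n. 0::nat}"
  have g0: "gaf_term L c' z (\<lambda>_. 0) = 0" "gaf_term L c z (\<lambda>_. 0) = c (\<lambda>_. 0)"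
    using Gamma_real_pos[OF L] by (simp_all add: gaf_term_def c'_def gaf_coeff_def mi_size_def mi_fact_def mi_power_def)
  have "gaf_term L c' z summable_on ?Z" 
    using growth(1) by (rule summable_on_subset_banach) auto
  also have "?this \<longleftrightarrow> gaf_term L c z summable_on ?Z"
    by (intro summable_on_cong) (auto simp: gaf_term_def c'_def)
  finally have s: "gaf_term L c z summable_on ?Z" .
  have "infsum (gaf_term L c z) UNIV = infsum (gaf_term L c z) (insert (\<lambda>_. 0) ?Z)"
    by (rule arg_cong[where f = "infsum _"]) auto
  also have "\<dots> = c (\<lambda>_. 0) + infsum (gaf_term L c z) ?Z"
    using s by (subst infsum_insert) (auto simp: g0)
  also have "infsum (gaf_term L c z) ?Z = infsum (gaf_term L c' z) UNIV"
    by (intro infsum_cong_neutral) (auto simp: g0 gaf_term_def c'_def)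
  finally have eq: "infsum (gaf_term L c z) UNIV = c (\<lambda>_. 0) + infsum (gaf_term L c' z) UNIV" .
  have "norm (infsum (gaf_term L c' z) UNIV) < norm (c (\<lambda>_. 0))"
    using growth(2) T by linarith
  then show ?thesis unfolding eq
    by (metis add_eq_0_iff2 norm_minus_cancel less_irrefl)
qed

section \<open>Probabilities of simultaneous bounds on all Gaussian coefficients\<close>

context prob_space
begin

lemma iid_gaussians:
  assumes "iid_standard_complex_gaussians M a"
  shows "indep_vars (\<lambda>_. borel) a UNIV" "\<And>\<alpha>. standard_complex_gaussian M (a \<alpha>)"
    "\<And>\<alpha>. a \<alpha> \<in> borel_measurable M"
  using assms standard_complex_gaussian_measurable unfolding iid_standard_complex_gaussians_def by auto

lemma prob_gaussian_cball_ge_tail: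
  assumes X: "standard_complex_gaussian M X" and t: "t \<ge> 0"
  shows "1 - 2 * exp (- t\<^sup>2 / 2) \<le> prob (X -` cball 0 t \<inter> space M)"
proof -
  have [measurable]: "X \<in> borel_measurable M" by (rule standard_complex_gaussian_measurable[OF X])
  have "X -` (- cball 0 t) \<inter> space M = space M - X -` cball 0 t \<inter> space M" by auto
  then have "prob (X -` (- cball 0 t) \<inter> space M) = 1 - prob (X -` cball 0 t \<inter> space M)"
    by (simp add: prob_compl)
  then show ?thesis using gaussian_tail_le[OF X t] by simp
qed

text \<open>The Gaussian tail at the threshold \<open>T / x ^ mi_size \<alpha>\<close> is at most a
  geometric factor in \<open>mi_size \<alpha>\<close> times a factor depending on \<open>T\<close>
  alone; summing over all multi-indices gives the loss.\<close>

lemma prob_growth_ge: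
  fixes a :: "('n::finite \<Rightarrow> nat) \<Rightarrow> 'a \<Rightarrow> complex"
  assumes iid: "iid_standard_complex_gaussians M a" and x: "0 < x" "x < 1" and T: "T \<ge> 1"
  shows "1 - 8 * exp (- T\<^sup>2 / 4) / (1 - x) ^ CARD('n)
    \<le> prob {\<omega>\<in>space M. \<forall>\<alpha>. norm (a \<alpha> \<omega>) * x ^ mi_size \<alpha> \<le> T}"
proof -
  define q where "q \<alpha> = 8 * exp (- T\<^sup>2 / 4) * x ^ mi_size \<alpha>" for \<alpha> :: "'n \<Rightarrow> nat"
  have q0: "q \<alpha> \<ge> 0" for \<alpha> using x by (simp add: q_def)
  let ?A = "\<lambda>\<alpha> :: 'n \<Rightarrow> nat. cball (0::complex) (T / x ^ mi_size \<alpha>)"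
  have p: "1 - q \<alpha> \<le> prob (a \<alpha> -` ?A \<alpha> \<inter> space M)" for \<alpha>
  proof -
    let ?k = "mi_size \<alpha>"
    define u where "u = (1 / x ^ ?k)\<^sup>2"
    have "x ^ ?k \<le> 1" "x ^ ?k > 0" using x by (auto simp: power_le_one)
    then have u: "u \<ge> 1" "1 / u \<le> x ^ ?k"
      by (auto simp: u_def power_one_over power_le_one power2_eq_square mult_le_one field_simps)
    have T2: "T\<^sup>2 \<ge> 1" using T by (simp add: one_le_power)
    \<comment> \<open>The tail exponent is a product of \<open>T\<^sup>2\<close> and
      \<open>u\<close>; as both are at least 1, it dominates a sum, which separates the dependence
      on \<open>T\<close> from that on \<alpha>.\<close>
    have "0 \<le> (T\<^sup>2 - 1) * (u - 1)" using T2 u by simp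
    then have *: "T\<^sup>2 * u / 2 \<ge> T\<^sup>2 / 4 + u / 4" using T2 u by (simp add: algebra_simps)
    have "2 * exp (- (T / x ^ ?k)\<^sup>2 / 2) = 2 * exp (- (T\<^sup>2 * u / 2))"
      by (simp add: u_def power_divide)
    also have "\<dots> \<le> 2 * exp (- (T\<^sup>2 / 4 + u / 4))" using * by simp
    also have "\<dots> = 2 * exp (- T\<^sup>2 / 4) * exp (- (u / 4))" by (simp flip: exp_add)
    \<comment> \<open>A rational bound suffices, since \<open>1 / u\<close> is already geometric in
      \<open>?k\<close>.\<close>
    also have "exp (- (u / 4)) \<le> 4 / u"
    proof -
      have "u / 4 \<le> exp (u / 4)" using exp_ge_add_one_self[of "u / 4"] by linarith
      then show ?thesis using u by (simp add: exp_minus field_simps)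
    qed
    also have "4 / u \<le> 4 * x ^ ?k" using u by simp
    finally have "2 * exp (- (T / x ^ ?k)\<^sup>2 / 2) \<le> q \<alpha>"
      by (simp add: q_def mult_left_mono)
    then show ?thesis
      using prob_gaussian_cball_ge_tail[OF iid_gaussians(2)[OF iid], of "T / x ^ ?k" \<alpha>] x T by simp
  qed
  define Q where "Q = 8 * exp (- T\<^sup>2 / 4) / (1 - x) ^ CARD('n)"
  have "1 - Q \<le> prob {\<omega>\<in>space M. \<forall>\<alpha>. a \<alpha> \<omega> \<in> ?A \<alpha>}"
  \<comment> \<open>For \<open>Q > 1\<close> the claimed lower bound is negative; otherwise every
    single \<open>q \<alpha>\<close> is at most 1, as the product inequality requires.\<close>
  proof (cases "Q \<le> 1")
    case True
    have sumq: "(\<Sum>\<alpha>\<in>S. q \<alpha>) \<le> Q" if "finite S" for S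
    proof -
      have "(\<Sum>\<alpha>\<in>S. q \<alpha>) = 8 * exp (- T\<^sup>2 / 4) * (\<Sum>\<alpha>\<in>S. x ^ mi_size \<alpha>)"
        by (simp add: q_def sum_distrib_left)
      also have "\<dots> \<le> 8 * exp (- T\<^sup>2 / 4) * (1 / (1 - x) ^ CARD('n))"
        using that x by (intro mult_left_mono sum_power_mi_size_le) auto
      finally show ?thesis by (simp add: Q_def)
    qed
    show ?thesis
    proof (rule indep_vars_prob_all_ge[OF iid_gaussians(1)[OF iid]])
      fix S :: "('n \<Rightarrow> nat) set" assume S: "finite S"
      have q1: "q \<alpha> \<le> 1" for \<alpha> using sumq[of "{\<alpha>}"] True by simp
      have "1 - Q \<le> 1 - (\<Sum>\<alpha>\<in>S. q \<alpha>)" using sumq[OF S] by simp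
      also have "\<dots> \<le> (\<Prod>\<alpha>\<in>S. 1 - q \<alpha>)"
        using S q0 q1 by (intro prod_ge_one_minus_sum) auto
      also have "\<dots> \<le> (\<Prod>\<alpha>\<in>S. prob (a \<alpha> -` ?A \<alpha> \<inter> space M))"
        using p q1 by (intro prod_mono) auto
      finally show "1 - Q \<le> (\<Prod>\<alpha>\<in>S. prob (a \<alpha> -` ?A \<alpha> \<inter> space M))" .
    qed auto
  next
    case False
    then show ?thesis using measure_nonneg[of M] by (smt (verit))
  qed
  also have "{\<omega>\<in>space M. \<forall>\<alpha>. a \<alpha> \<omega> \<in> ?A \<alpha>} = {\<omega>\<in>space M. \<forall>\<alpha>. norm (a \<alpha> \<omega>) * x ^ mi_size \<alpha> \<le> T}"
    using x by (simp add: field_simps)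
  finally show ?thesis by (simp add: Q_def)
qed

text \<open>The at most \<open>(K + 1) ^ CARD('n)\<close> indices with
  \<open>mi_size \<alpha> \<le> K\<close> are each charged the small-ball probability
  \<open>T\<^sup>2 / exp 1\<close>. Beyond \<open>K\<close> the thresholds are so generous, by the
  hypothesis on \<open>K\<close>, that all larger indices together cost at most a factor
  1/2.\<close>

lemma prob_small_coeffs_ge:
  fixes a :: "('n::finite \<Rightarrow> nat) \<Rightarrow> 'a \<Rightarrow> complex"
  assumes iid: "iid_standard_complex_gaussians M a" and x: "0 < x" "x < 1" and T: "0 < T" "T \<le> 1"
    and K: "8 * x ^ K \<le> T\<^sup>2 * (1 - x) ^ CARD('n)"
  shows "(T\<^sup>2 / exp 1) ^ ((K + 1) ^ CARD('n)) / 2 \<le> prob {\<omega>\<in>space M.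
    1 / 2 \<le> norm (a (\<lambda>_. 0) \<omega>) \<and> (\<forall>\<alpha>. \<alpha> \<noteq> (\<lambda>_. 0) \<longrightarrow> norm (a \<alpha> \<omega>) * x ^ mi_size \<alpha> \<le> T)}"
proof -
  let ?A = "\<lambda>\<alpha> :: 'n \<Rightarrow> nat. if \<alpha> = (\<lambda>_. 0) then - ball (0::complex) (1 / 2) else cball 0 (T / x ^ mi_size \<alpha>)"
  let ?p = "\<lambda>\<alpha>. prob (a \<alpha> -` ?A \<alpha> \<inter> space M)"
  let ?\<tau> = "T\<^sup>2 / exp 1"
  have [measurable]: "a \<alpha> \<in> borel_measurable M" for \<alpha> by (rule iid_gaussians(3)[OF iid])
  have T2: "0 < T\<^sup>2" "T\<^sup>2 \<le> 1" using T by (auto simp: power_le_one)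
  have "(1::real) \<le> exp 1" by simp
  then have \<tau>: "0 < ?\<tau>" "?\<tau> \<le> 1" using T2 by (auto simp: field_simps intro: order_trans)
  have small: "?\<tau> \<le> ?p \<alpha>" for \<alpha>
  proof (cases "\<alpha> = (\<lambda>_. 0)")
    \<comment> \<open>The constant term must be large instead of small; this has probability at
      least 3/4 and so obeys the same lower bound.\<close>
    case True
    have "space M - a \<alpha> -` (- ball 0 (1 / 2)) \<inter> space M \<subseteq> a \<alpha> -` cball 0 (1 / 2) \<inter> space M"
      by auto
    then have "prob (space M - a \<alpha> -` (- ball 0 (1 / 2)) \<inter> space M) \<le> prob (a \<alpha> -` cball 0 (1 / 2) \<inter> space M)"
      by (intro finite_measure_mono) auto
    also have "\<dots> \<le> (1 / 2)\<^sup>2"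
      by (rule gaussian_prob_cball_le[OF iid_gaussians(2)[OF iid]]) simp
    finally have "1 - prob (a \<alpha> -` (- ball 0 (1 / 2)) \<inter> space M) \<le> 1 / 4"
      by (subst (asm) prob_compl) (auto simp: power2_eq_square)
    moreover have "?\<tau> \<le> 1 / 2"
    proof -
      have "(2::real) \<le> exp 1" using exp_ge_add_one_self[of 1] by simp
      then have "1 / exp 1 \<le> (1 / 2 :: real)" by (simp add: field_simps)
      moreover have "?\<tau> \<le> 1 / exp 1" using T2 by (intro divide_right_mono) auto
      ultimately show ?thesis by linarith
    qed
    ultimately have "?\<tau> \<le> prob (a \<alpha> -` (- ball 0 (1 / 2)) \<inter> space M)" by linarith
    then show ?thesis using True by simp
  next
    case False
    have "x ^ mi_size \<alpha> \<le> 1" "x ^ mi_size \<alpha> > 0" using x by (auto simp: power_le_one)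
    then have le: "T \<le> T / x ^ mi_size \<alpha>" using T by (simp add: field_simps)
    have "?\<tau> \<le> prob (a \<alpha> -` cball 0 T \<inter> space M)"
      using T by (intro gaussian_prob_cball_ge iid_gaussians(2)[OF iid]) auto
    also have "\<dots> \<le> prob (a \<alpha> -` cball 0 (T / x ^ mi_size \<alpha>) \<inter> space M)"
      using le by (intro finite_measure_mono) auto
    finally show ?thesis using False by simp
  qed
  \<comment> \<open>The tail bound \<open>4 / t\<^sup>2\<close> at
    \<open>t = T / x ^ mi_size \<alpha>\<close> contains \<open>x ^ mi_size \<alpha>\<close> twice;
    one copy is estimated by \<open>x ^ K\<close>, the other keeps the sum finite.\<close>
  define q where "q \<alpha> = 4 / T\<^sup>2 * x ^ K * x ^ mi_size \<alpha>" for \<alpha> :: "'n \<Rightarrow> nat"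
  have q0: "q \<alpha> \<ge> 0" for \<alpha> using x by (simp add: q_def)
  have big: "1 - q \<alpha> \<le> ?p \<alpha>" if "K < mi_size \<alpha>" for \<alpha>
  proof -
    let ?k = "mi_size \<alpha>"
    have "\<alpha> \<noteq> (\<lambda>_. 0)" using that by (auto simp: mi_size_def)
    define t where "t = T / x ^ ?k"
    have t: "t > 0" using x T by (simp add: t_def)
    have "t\<^sup>2 / 2 \<le> exp (t\<^sup>2 / 2)" using exp_ge_add_one_self[of "t\<^sup>2 / 2"] by linarith
    then have "2 * exp (- t\<^sup>2 / 2) \<le> 4 / t\<^sup>2"
      using t by (simp add: exp_minus field_simps)
    also have "\<dots> = 4 / T\<^sup>2 * (x ^ ?k * x ^ ?k)"
      using x by (simp add: t_def power_divide power2_eq_square)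
    also have "\<dots> \<le> 4 / T\<^sup>2 * (x ^ K * x ^ ?k)"
      using x that by (intro mult_left_mono mult_right_mono power_decreasing) auto
    also have "\<dots> = q \<alpha>" by (simp add: q_def)
    finally show ?thesis
      using prob_gaussian_cball_ge_tail[OF iid_gaussians(2)[OF iid], of t \<alpha>] t \<open>\<alpha> \<noteq> _\<close>
      by (simp add: t_def)
  qed
  have sumq: "(\<Sum>\<alpha>\<in>S. q \<alpha>) \<le> 1 / 2" if "finite S" for S
  proof -
    have "(\<Sum>\<alpha>\<in>S. q \<alpha>) = 4 / T\<^sup>2 * x ^ K * (\<Sum>\<alpha>\<in>S. x ^ mi_size \<alpha>)"
      by (simp add: q_def sum_distrib_left)
    also have "\<dots> \<le> 4 / T\<^sup>2 * x ^ K * (1 / (1 - x) ^ CARD('n))"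
      using that x by (intro mult_left_mono sum_power_mi_size_le) auto
    also have "\<dots> \<le> 1 / 2"
      using K x T by (simp add: field_simps)
    finally show ?thesis .
  qed
  have q1: "q \<alpha> \<le> 1" for \<alpha> using sumq[of "{\<alpha>}"] by simp
  have "?\<tau> ^ ((K + 1) ^ CARD('n)) / 2 \<le> prob {\<omega>\<in>space M. \<forall>\<alpha>. a \<alpha> \<omega> \<in> ?A \<alpha>}"
  proof (rule indep_vars_prob_all_ge[OF iid_gaussians(1)[OF iid]])
    fix S :: "('n \<Rightarrow> nat) set" assume S: "finite S"
    define S1 S2 where "S1 = {\<alpha>\<in>S. mi_size \<alpha> \<le> K}" and "S2 = {\<alpha>\<in>S. K < mi_size \<alpha>}"
    have fin: "finite S1" "finite S2" and S12: "S = S1 \<union> S2" "S1 \<inter> S2 = {}"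
      using S by (auto simp: S1_def S2_def)
    have "card S1 \<le> card {\<alpha> :: 'n \<Rightarrow> nat. mi_size \<alpha> \<le> K}"
      by (intro card_mono finite_mi_size_le) (auto simp: S1_def)
    also have "\<dots> \<le> (K + 1) ^ CARD('n)" by (rule card_mi_size_le)
    finally have card: "card S1 \<le> (K + 1) ^ CARD('n)" .
    have "?\<tau> ^ ((K + 1) ^ CARD('n)) \<le> ?\<tau> ^ card S1"
      using \<tau> card by (intro power_decreasing) auto
    also have "\<dots> \<le> (\<Prod>\<alpha>\<in>S1. ?p \<alpha>)"
      using small \<tau> unfolding prod_constant[symmetric] by (intro prod_mono) auto
    finally have 1: "?\<tau> ^ ((K + 1) ^ CARD('n)) \<le> (\<Prod>\<alpha>\<in>S1. ?p \<alpha>)" .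
    have "1 / 2 \<le> 1 - (\<Sum>\<alpha>\<in>S2. q \<alpha>)" using sumq[OF fin(2)] by simp
    also have "\<dots> \<le> (\<Prod>\<alpha>\<in>S2. 1 - q \<alpha>)"
      using fin q0 q1 by (intro prod_ge_one_minus_sum) auto
    also have "\<dots> \<le> (\<Prod>\<alpha>\<in>S2. ?p \<alpha>)"
      using big q1 by (intro prod_mono) (auto simp: S2_def)
    finally have 2: "1 / 2 \<le> (\<Prod>\<alpha>\<in>S2. ?p \<alpha>)" .
    have "?\<tau> ^ ((K + 1) ^ CARD('n)) * (1 / 2) \<le> (\<Prod>\<alpha>\<in>S1. ?p \<alpha>) * (\<Prod>\<alpha>\<in>S2. ?p \<alpha>)"
      using 1 2 \<tau> by (intro mult_mono prod_nonneg) auto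
    also have "\<dots> = (\<Prod>\<alpha>\<in>S. ?p \<alpha>)"
      unfolding S12(1) by (rule prod.union_disjoint[OF fin S12(2), symmetric])
    finally show "?\<tau> ^ ((K + 1) ^ CARD('n)) / 2 \<le> (\<Prod>\<alpha>\<in>S. ?p \<alpha>)" by simp
  qed auto
  also have "{\<omega>\<in>space M. \<forall>\<alpha>. a \<alpha> \<omega> \<in> ?A \<alpha>} = {\<omega>\<in>space M.
    1 / 2 \<le> norm (a (\<lambda>_. 0) \<omega>) \<and> (\<forall>\<alpha>. \<alpha> \<noteq> (\<lambda>_. 0) \<longrightarrow> norm (a \<alpha> \<omega>) * x ^ mi_size \<alpha> \<le> T)}"
    using x by (auto simp: field_simps split: if_splits)
  finally show ?thesis .
qed

end

subsection \<open>Restriction to a monomial curve\<close>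

text \<open>Kept abstract in the index type and the weight: the conditioning argument uses only that
  different degrees \<open>j\<close> involve disjoint sets of Gaussians.\<close>

definition graded_sum :: "('i \<Rightarrow> nat) \<Rightarrow> ('i \<Rightarrow> real) \<Rightarrow> ('i \<Rightarrow> complex) \<Rightarrow> nat \<Rightarrow> complex" where
  "graded_sum wt s c j = (\<Sum>\<alpha> | wt \<alpha> = j. c \<alpha> * of_real (s \<alpha>))"

text \<open>Induction with the largest degree \<open>b\<close> added last. The conditions in lower
  degrees do not involve the Gaussian at \<open>\<beta> b\<close>, whose weight is \<open>b\<close>.
  Given all other Gaussians, the condition in degree \<open>b\<close> confines it to a disc of
  radius \<open>C / s (\<beta> b)\<close>, which yields one factor of the product.\<close>

lemma (in prob_space) prob_log_rest_le:
  fixes a :: "'i \<Rightarrow> 'a \<Rightarrow> complex"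
  assumes ind: "indep_vars (\<lambda>_. borel) a UNIV" and gauss: "\<And>\<alpha>. standard_complex_gaussian M (a \<alpha>)"
    and fin: "\<And>j. finite {\<alpha>. wt \<alpha> = j}" and s: "\<And>\<alpha>. s \<alpha> > 0" and "C \<ge> 0"
    and J: "finite J" "\<And>j. j \<in> J \<Longrightarrow> wt (\<beta> j) = j"
  defines "\<phi> \<equiv> \<lambda>\<omega>. graded_sum wt s (\<lambda>\<alpha>. a \<alpha> \<omega>)"
  shows "prob {\<omega>\<in>space M. \<forall>j\<in>J. cmod (\<phi> \<omega> j - log_rest (\<phi> \<omega>) j) \<le> C}
    \<le> (\<Prod>j\<in>J. (C / s (\<beta> j))\<^sup>2)"
  using J
proof (induction J rule: finite_linorder_max_induct)
  case empty
  then show ?case by (simp add: prob_space)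
next
  case (insert b A)
  define B where "B = UNIV - {\<beta> b}"
  define N where "N = PiM B (\<lambda>_. borel :: complex measure)"
  define Y where "Y = (\<lambda>\<omega>. restrict (\<lambda>\<alpha>. a \<alpha> \<omega>) B)"
  have lb: "wt (\<beta> b) = b" using insert.prems by auto
  have ind': "indep_var (PiM {\<beta> b} (\<lambda>_. borel)) (\<lambda>\<omega>. restrict (\<lambda>\<alpha>. a \<alpha> \<omega>) {\<beta> b}) N Y"
    unfolding N_def Y_def B_def by (rule indep_var_restrict[OF ind]) auto
  \<comment> \<open>Coefficients from degree \<open>b\<close> on are cut off, so that \<psi> depends
    only on Gaussians other than the one at \<open>\<beta> b\<close>; up to degree \<open>b\<close>,
    \<open>log_rest\<close> does not see the difference.\<close>
  define \<psi> where "\<psi> y j = (if j < b then graded_sum wt s y j else 0)" for y j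
  have comp: "(\<lambda>y. y \<alpha>) \<in> borel_measurable N" if "\<alpha> \<noteq> \<beta> b" for \<alpha>
    unfolding N_def using that by (intro measurable_component_singleton) (auto simp: B_def)
  have psi: "(\<lambda>y. \<psi> y j) \<in> borel_measurable N" for j
  proof (cases "j < b")
    case True
    have "(\<lambda>y. graded_sum wt s y j) \<in> borel_measurable N"
      unfolding graded_sum_def using True lb
      by (intro borel_measurable_sum borel_measurable_times comp borel_measurable_const) auto
    then show ?thesis using True by (simp add: \<psi>_def)
  qed (simp add: \<psi>_def)
  have [measurable]: "(\<lambda>y. \<psi> y j) \<in> borel_measurable N" "(\<lambda>y. log_rest (\<psi> y) j) \<in> borel_measurable N" for j
    by (intro measurable_log_rest psi)+
  define R where "R = {\<alpha>. wt \<alpha> = b} - {\<beta> b}"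
  have [measurable]: "(\<lambda>y. \<Sum>\<alpha>\<in>R. y \<alpha> * of_real (s \<alpha>)) \<in> borel_measurable N"
    by (intro borel_measurable_sum borel_measurable_times comp borel_measurable_const) (auto simp: R_def)
  \<comment> \<open>The centre of the disc, found by solving the degree \<open>b\<close> coefficient
    for the Gaussian at \<open>\<beta> b\<close>.\<close>
  define h where "h y = (log_rest (\<psi> y) b - (\<Sum>\<alpha>\<in>R. y \<alpha> * of_real (s \<alpha>))) / of_real (s (\<beta> b))" for y
  have h: "h \<in> borel_measurable N" unfolding h_def by measurable
  define E where "E = {y \<in> space N. \<forall>j\<in>A. cmod (\<psi> y j - log_rest (\<psi> y) j) \<le> C}"
  have E: "E \<in> sets N" unfolding E_def using insert.hyps(1) by measurable
  have YN: "Y \<omega> \<in> space N" if "\<omega> \<in> space M" for \<omega>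
    using measurable_space[OF indep_var_rv2[OF ind'] that] .
  have lower: "\<psi> (Y \<omega>) j = \<phi> \<omega> j" if "j < b" for \<omega> j
    using that lb unfolding \<psi>_def \<phi>_def graded_sum_def Y_def B_def by (auto intro!: sum.cong)
  have rest: "log_rest (\<psi> (Y \<omega>)) j = log_rest (\<phi> \<omega>) j" if "j \<le> b" for \<omega> j
    using that by (intro log_rest_cong lower) auto
  have EA: "Y \<omega> \<in> E \<longleftrightarrow> (\<forall>j\<in>A. cmod (\<phi> \<omega> j - log_rest (\<phi> \<omega>) j) \<le> C)" if "\<omega> \<in> space M" for \<omega>
    using insert.hyps(2) YN[OF that] by (auto simp: E_def lower rest less_imp_le)
  have top: "cmod (\<phi> \<omega> b - log_rest (\<phi> \<omega>) b) \<le> C \<longleftrightarrow>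
    cmod (a (\<beta> b) \<omega> - h (Y \<omega>)) \<le> C / s (\<beta> b)" for \<omega>
  proof -
    have "\<phi> \<omega> b = a (\<beta> b) \<omega> * of_real (s (\<beta> b)) + (\<Sum>\<alpha>\<in>R. a \<alpha> \<omega> * of_real (s \<alpha>))"
      unfolding \<phi>_def graded_sum_def R_def by (rule sum.remove) (use fin lb in auto)
    moreover have "(\<Sum>\<alpha>\<in>R. Y \<omega> \<alpha> * of_real (s \<alpha>)) = (\<Sum>\<alpha>\<in>R. a \<alpha> \<omega> * of_real (s \<alpha>))"
      by (intro sum.cong) (auto simp: Y_def B_def R_def)
    ultimately have "\<phi> \<omega> b - log_rest (\<phi> \<omega>) b = (a (\<beta> b) \<omega> - h (Y \<omega>)) * of_real (s (\<beta> b))"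
      using s[of "\<beta> b"] rest[of b \<omega>] unfolding h_def by (simp add: field_simps)
    then show ?thesis using s[of "\<beta> b"] by (simp add: norm_mult pos_le_divide_eq)
  qed
  have "prob {\<omega>\<in>space M. \<forall>j\<in>insert b A. cmod (\<phi> \<omega> j - log_rest (\<phi> \<omega>) j) \<le> C}
    = prob {\<omega>\<in>space M. Y \<omega> \<in> E \<and> cmod (a (\<beta> b) \<omega> - h (Y \<omega>)) \<le> C / s (\<beta> b)}"
    by (intro arg_cong[where f = prob]) (auto simp: EA top)
  also have "\<dots> \<le> (C / s (\<beta> b))\<^sup>2 * prob {\<omega>\<in>space M. Y \<omega> \<in> E}"
    using s[of "\<beta> b"] \<open>C \<ge> 0\<close>
    using gaussian_small_ball_indep[OF _ ind' _ h E, of "\<lambda>f. f (\<beta> b)" "C / s (\<beta> b)"] gauss[of "\<beta> b"]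
    by simp
  also have "{\<omega>\<in>space M. Y \<omega> \<in> E} = {\<omega>\<in>space M. \<forall>j\<in>A. cmod (\<phi> \<omega> j - log_rest (\<phi> \<omega>) j) \<le> C}"
    by (auto simp: EA)
  also have "(C / s (\<beta> b))\<^sup>2 * prob \<dots> \<le> (C / s (\<beta> b))\<^sup>2 * (\<Prod>j\<in>A. (C / s (\<beta> j))\<^sup>2)"
    using insert by (intro mult_left_mono) auto
  also have "\<dots> = (\<Prod>j\<in>insert b A. (C / s (\<beta> j))\<^sup>2)"
    using insert.hyps by auto
  finally show ?case .
qed

section \<open>The slice along the curve and its Taylor coefficients\<close>

definition mi_weight :: "('n::finite \<Rightarrow> nat) \<Rightarrow> ('n \<Rightarrow> nat) \<Rightarrow> nat" where
  "mi_weight d \<alpha> = (\<Sum>i\<in>UNIV. \<alpha> i * d i)"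

lemma finite_mi_weight_eq:
  assumes "\<And>i. d i \<ge> 1"
  shows "finite {\<alpha> :: 'n::finite \<Rightarrow> nat. mi_weight d \<alpha> = j}"
proof (rule finite_subset[OF _ finite_mi_size_le])
  have "\<alpha> i \<le> \<alpha> i * d i" for \<alpha> :: "'n \<Rightarrow> nat" and i
    using assms[of i] by simp
  then have "mi_size \<alpha> \<le> mi_weight d \<alpha>" for \<alpha>
    unfolding mi_size_def mi_weight_def by (intro sum_mono)
  then show "{\<alpha>. mi_weight d \<alpha> = j} \<subseteq> {\<alpha>. mi_size \<alpha> \<le> j}" by auto
qed

definition power_curve :: "real \<Rightarrow> ('n::finite \<Rightarrow> nat) \<Rightarrow> complex \<Rightarrow> complex ^ 'n" where
  "power_curve \<rho> d t = (\<chi> i. of_real \<rho> * t ^ d i)"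

lemma mi_power_power_curve:
  "mi_power (power_curve \<rho> d t) \<alpha> = of_real (\<rho> ^ mi_size \<alpha>) * t ^ mi_weight d \<alpha>"
  unfolding mi_power_def power_curve_def mi_size_def mi_weight_def
  by (simp add: power_mult_distrib prod.distrib power_sum mult.commute[of _ "d _"] power_mult)

lemma norm_power_curve_le:
  assumes "\<rho> \<ge> 0" "norm t \<le> 1"
  shows "norm (power_curve \<rho> d t :: complex ^ 'n::finite) \<le> real CARD('n) * \<rho>"
proof -
  have "norm (power_curve \<rho> d t) \<le> (\<Sum>i\<in>UNIV. norm (power_curve \<rho> d t $ i))"
    unfolding norm_vec_def by (rule L2_set_le_sum) auto
  also have "\<dots> \<le> (\<Sum>i\<in>(UNIV :: 'n set). \<rho>)"
    using assms by (intro sum_mono) (auto simp: power_curve_def norm_mult norm_power mult_left_le power_le_one)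
  finally show ?thesis by simp
qed

abbreviation slice_coeff :: "real \<Rightarrow> real \<Rightarrow> ('n::finite \<Rightarrow> nat) \<Rightarrow> (('n \<Rightarrow> nat) \<Rightarrow> complex) \<Rightarrow> nat \<Rightarrow> complex" where
  "slice_coeff L \<rho> d \<equiv> graded_sum (mi_weight d) (\<lambda>\<alpha>. gaf_coeff L \<alpha> * \<rho> ^ mi_size \<alpha>)"

text \<open>An unordered convergent sum may be regrouped along the finite fibres of
  \<open>mi_weight d\<close>; each fibre contributes one power of \<open>t\<close>.\<close>

lemma slice_sums:
  assumes d: "\<And>i. d i \<ge> 1" and s: "gaf_term L c (power_curve \<rho> d t) summable_on UNIV"
  shows "(\<lambda>j. slice_coeff L \<rho> d c j * t ^ j) sums infsum (gaf_term L c (power_curve \<rho> d t)) UNIV"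
proof (rule has_sum_imp_sums, rule has_sum_SigmaD)
  let ?g = "gaf_term L c (power_curve \<rho> d t)"
  have bij: "bij_betw snd (Sigma UNIV (\<lambda>j. {\<alpha>. mi_weight d \<alpha> = j})) UNIV"
    by (rule bij_betwI[where g = "\<lambda>\<alpha>. (mi_weight d \<alpha>, \<alpha>)"]) auto
  show "((\<lambda>p. ?g (snd p)) has_sum infsum ?g UNIV) (Sigma UNIV (\<lambda>j. {\<alpha>. mi_weight d \<alpha> = j}))"
    using s by (simp add: has_sum_reindex_bij_betw[OF bij])
  fix j
  have "((\<lambda>\<alpha>. ?g \<alpha>) has_sum (\<Sum>\<alpha> | mi_weight d \<alpha> = j. ?g \<alpha>)) {\<alpha>. mi_weight d \<alpha> = j}"
    by (intro has_sum_finite finite_mi_weight_eq d)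
  also have "(\<Sum>\<alpha> | mi_weight d \<alpha> = j. ?g \<alpha>) = slice_coeff L \<rho> d c j * t ^ j"
    unfolding graded_sum_def sum_distrib_right
    by (intro sum.cong) (auto simp: gaf_term_def mi_power_power_curve)
  finally show "((\<lambda>\<alpha>. ?g (snd (j, \<alpha>))) has_sum slice_coeff L \<rho> d c j * t ^ j) {\<alpha>. mi_weight d \<alpha> = j}"
    by simp
qed

lemma slice_coeff_0:
  assumes "L > 0" "\<And>i. d i \<ge> 1"
  shows "slice_coeff L \<rho> d c 0 = c (\<lambda>_. 0)"
proof -
  have nz: "d i \<noteq> 0" for i using assms(2)[of i] by linarith
  have "{\<alpha>. mi_weight d \<alpha> = 0} = {\<lambda>_. 0}" by (simp add: mi_weight_def fun_eq_iff set_eq_iff nz)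
  then show ?thesis
    using Gamma_real_pos[OF assms(1)] by (simp add: graded_sum_def gaf_coeff_def mi_size_def mi_fact_def)
qed

text \<open>The curve maps the open unit disc into the ball of radius \<open>x ^ 4\<close>, so the
  slice inherits zero-freeness and the growth bound. Its value at 0 is the constant coefficient, of
  modulus at most \<open>T\<close>.\<close>

lemma slice_log_rest_bound:
  fixes c :: "('n::finite \<Rightarrow> nat) \<Rightarrow> complex"
  assumes L: "L > 0" and x: "0 < x" "x < 1" and d: "\<And>i. d i \<ge> 1"
    and \<rho>: "0 \<le> \<rho>" "real CARD('n) * \<rho> < x ^ 4"
    and c: "\<And>\<alpha>. norm (c \<alpha>) * x ^ mi_size \<alpha> \<le> T"
    and nz: "\<And>z. z \<in> ball 0 (x ^ 4) \<Longrightarrow> infsum (gaf_term L c z) UNIV \<noteq> 0"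
    and B: "T * (1 - x ^ 4) powr (- L / 2) / (1 - x) ^ CARD('n) \<le> exp B" "B \<ge> 0" and "j \<ge> 1"
  defines "\<phi> \<equiv> slice_coeff L \<rho> d c"
  shows "norm (\<phi> j - log_rest \<phi> j) \<le> 2 * exp 1 * (real j + 1) * (T * (B + 1) + 1)"
proof -
  let ?F = "\<lambda>t. infsum (gaf_term L c (power_curve \<rho> d t)) UNIV"
  have curve: "norm (power_curve \<rho> d t :: complex ^ 'n) < x ^ 4" if "norm t < 1" for t
    using norm_power_curve_le[of \<rho> t d] \<rho> that by simp
  note growth = gaf_series_growth[OF L x c]
  have "norm (\<phi> j - log_rest \<phi> j) \<le> 2 * exp 1 * (real j + 1) * (norm (\<phi> 0) * (B + 1) + 1)"
  proof (rule nonvanishing_coeff_bound)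
    fix t :: complex assume t: "norm t < 1"
    note z = less_imp_le[OF curve[OF t]]
    show "(\<lambda>j. \<phi> j * t ^ j) sums ?F t"
      unfolding \<phi>_def by (intro slice_sums d growth(1) z)
    show "?F t \<noteq> 0" using curve[OF t] by (intro nz) auto
    show "norm (?F t) \<le> exp B" using growth(2)[OF z] B(1) by linarith
  qed fact+
  also have "\<dots> \<le> 2 * exp 1 * (real j + 1) * (T * (B + 1) + 1)"
    using c[of "\<lambda>_. 0"] B(2) unfolding \<phi>_def slice_coeff_0[OF L d]
    by (intro mult_left_mono add_right_mono mult_right_mono) (auto simp: mi_size_def)
  finally show ?thesis .
qed

subsection \<open>The hole probability\<close>

lemma ex_power_le_exp:
  fixes A \<epsilon> :: real
  assumes "\<epsilon> > 0"
  shows "\<exists>L\<^sub>0\<ge>1. \<forall>L\<ge>L\<^sub>0. A * L ^ N \<le> exp (\<epsilon> * L)"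
proof -
  have "((\<lambda>L. (\<epsilon> * L) ^ N / exp (\<epsilon> * L)) \<longlongrightarrow> 0) at_top"
    by (rule filterlim_compose[OF tendsto_power_div_exp_0])
       (intro filterlim_tendsto_pos_mult_at_top[OF tendsto_const assms] filterlim_ident)
  then have "((\<lambda>L. A / \<epsilon> ^ N * ((\<epsilon> * L) ^ N / exp (\<epsilon> * L))) \<longlongrightarrow> A / \<epsilon> ^ N * 0) at_top"
    by (intro tendsto_intros)
  then have "eventually (\<lambda>L. A / \<epsilon> ^ N * ((\<epsilon> * L) ^ N / exp (\<epsilon> * L)) < 1) at_top"
    by (rule order_tendstoD) simp
  then obtain L1 where L1: "\<And>L. L \<ge> L1 \<Longrightarrow> A / \<epsilon> ^ N * ((\<epsilon> * L) ^ N / exp (\<epsilon> * L)) < 1"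
    unfolding eventually_at_top_linorder by blast
  have "A * L ^ N \<le> exp (\<epsilon> * L)" if "L \<ge> max 1 L1" for L
    using L1[of L] that assms by (simp add: power_mult_distrib field_simps)
  then show ?thesis by (intro exI[of _ "max 1 L1"]) auto
qed

definition hole_event :: "'w measure \<Rightarrow> (('n::finite \<Rightarrow> nat) \<Rightarrow> 'w \<Rightarrow> complex) \<Rightarrow> real \<Rightarrow> real \<Rightarrow> 'w set" where
  "hole_event M a L r = {\<omega>\<in>space M. \<forall>z\<in>ball 0 r. infsum (gaf_term L (\<lambda>\<alpha>. a \<alpha> \<omega>) z) UNIV \<noteq> 0}"

lemma hole_event_eq:
  assumes "r < 1"
  shows "{\<omega>\<in>space M. zero_set (hyperbolic_GAF L a \<omega>) \<inter> ball 0 r = {}} = hole_event M a L r"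
proof -
  have "z \<in> ball 0 1" if "z \<in> ball 0 r" for z :: "complex ^ 'b" using that assms by simp
  then show ?thesis unfolding hole_event_def zero_set_def hyperbolic_GAF_eq by blast
qed

context prob_space
begin

lemma hole_event_measurable:
  assumes iid: "iid_standard_complex_gaussians M a" and "r > 0"
  shows "hole_event M a L r \<in> events"
  unfolding hole_event_def gaf_term_def[abs_def]
  by (intro measurable_nonvanishing borel_measurable_times borel_measurable_const
    iid_gaussians(3)[OF iid] \<open>r > 0\<close>)

text \<open>The exponent is a cost of at most \<open>(1 + c\<^sub>1 + c\<^sub>2) * L\<close> per
  index times at most \<open>((\<kappa> + 2) * L) ^ CARD('n)\<close> indices; the final
  \<open>+ 1\<close> absorbs the factor 1/2.\<close>

lemma prob_hole_ge:
  fixes a :: "('n::finite \<Rightarrow> nat) \<Rightarrow> 'a \<Rightarrow> complex"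
  assumes iid: "iid_standard_complex_gaussians M a" and L: "L \<ge> 1" and x: "0 < x" "x < 1"
  defines "c\<^sub>1 \<equiv> ln (1 / (1 - x ^ 4))" and "c\<^sub>2 \<equiv> 3 * CARD('n) * ln (1 / (1 - x)) + ln 128"
  shows "exp (- ((1 + c\<^sub>1 + c\<^sub>2) * ((c\<^sub>1 + c\<^sub>2) / ln (1 / x) + 2) ^ CARD('n) + 1) * L ^ (CARD('n) + 1))
    \<le> prob (hole_event M a L (x ^ 4))"
proof -
  let ?n = "CARD('n)"
  have x4: "0 < x ^ 4" "x ^ 4 < 1" using x by (auto simp: power_less_one_iff)
  have "ln (1 / (1 - x)) \<ge> 0" "ln (1 / (1 - x ^ 4)) \<ge> 0" using x x4 by (auto intro!: ln_ge_zero)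
  then have c: "c\<^sub>1 \<ge> 0" "c\<^sub>2 \<ge> 0" "ln (1 / x) > 0"
    using x unfolding c\<^sub>1_def c\<^sub>2_def by (auto intro!: add_nonneg_nonneg mult_nonneg_nonneg)
  \<comment> \<open>Chosen so that the bound on the non-constant terms in \<open>gaf_nonzero\<close>
    becomes exactly 1/4, below the 1/2 demanded of the constant term.\<close>
  define T where "T = (1 - x) ^ ?n * (1 - x ^ 4) powr (L / 2) / 4"
  have powr: "0 < (1 - x ^ 4) powr (L / 2)" "(1 - x ^ 4) powr (L / 2) \<le> 1"
    using x4 L by (auto intro: powr_le1)
  have pow: "0 < (1 - x) ^ ?n" "(1 - x) ^ ?n \<le> 1" using x by (auto intro: power_le_one)
  have T: "0 < T" using powr pow by (simp add: T_def)
  have "(1 - x) ^ ?n * (1 - x ^ 4) powr (L / 2) \<le> 1" using powr pow by (intro mult_le_one) auto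
  then have T1: "T \<le> 1" by (simp add: T_def)
  have lnT: "ln T = - ?n * ln (1 / (1 - x)) - L / 2 * c\<^sub>1 - ln 4"
    using x x4 unfolding T_def c\<^sub>1_def by (simp add: ln_mult ln_div ln_realpow ln_powr)
  \<comment> \<open>The 128 in \<open>c\<^sub>2\<close> is the 8 from the condition on
    \<open>K\<close> times the square of the 4 in \<open>T\<close>. Likewise its factor 3 counts two
    powers of \<open>(1 - x) ^ ?n\<close> from \<open>T\<^sup>2\<close> and one from that
    condition.\<close>
  have ln128: "ln 128 = ln 8 + 2 * ln (4::real)"
  proof -
    have "ln (8 * (4::real) ^ 2) = ln 8 + ln (4 ^ 2)" by (rule ln_mult_pos) auto
    also have "ln ((4::real) ^ 2) = 2 * ln 4" by (subst ln_realpow) auto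
    finally show ?thesis by simp
  qed
  define \<kappa> where "\<kappa> = (c\<^sub>1 + c\<^sub>2) / ln (1 / x)"
  have \<kappa>: "\<kappa> \<ge> 0" using c by (simp add: \<kappa>_def)
  \<comment> \<open>Linear in \<open>L\<close>, yet large enough for \<open>8 * x ^ K\<close> to
    fall below \<open>T\<^sup>2 * (1 - x) ^ ?n\<close>.\<close>
  define K where "K = nat \<lceil>\<kappa> * L\<rceil>"
  have K: "\<kappa> * L \<le> K" "K \<le> \<kappa> * L + 1"
    using \<kappa> L unfolding K_def by (auto simp: of_nat_nat) 
  have K1: "8 * x ^ K \<le> T\<^sup>2 * (1 - x) ^ ?n"
  proof -
    have "(c\<^sub>1 + c\<^sub>2) * L = \<kappa> * L * ln (1 / x)" using c by (simp add: \<kappa>_def)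
    also have "\<dots> \<le> K * ln (1 / x)" using K(1) c by (intro mult_right_mono) auto
    finally have "(c\<^sub>1 + c\<^sub>2) * L \<le> K * ln (1 / x)" .
    moreover have "c\<^sub>2 * 1 \<le> c\<^sub>2 * L" using c L by (intro mult_left_mono) auto
    ultimately have "L * c\<^sub>1 + c\<^sub>2 \<le> K * ln (1 / x)" by (simp add: algebra_simps)
    then have "ln (8 * x ^ K) \<le> ln (T\<^sup>2 * (1 - x) ^ ?n)"
      using x T by (simp add: ln_mult ln_realpow lnT ln_div ln128 c\<^sub>2_def algebra_simps)
    then show ?thesis using x T by (subst (asm) ln_le_cancel_iff) auto
  qed
  let ?E = "{\<omega>\<in>space M. 1 / 2 \<le> norm (a (\<lambda>_. 0) \<omega>) \<and>
    (\<forall>\<alpha>. \<alpha> \<noteq> (\<lambda>_. 0) \<longrightarrow> norm (a \<alpha> \<omega>) * x ^ mi_size \<alpha> \<le> T)}"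
  have sub: "?E \<subseteq> hole_event M a L (x ^ 4)"
    unfolding hole_event_def
  proof (intro subsetI CollectI conjI ballI)
    fix \<omega> z assume \<omega>: "\<omega> \<in> ?E" and z: "z \<in> ball (0 :: complex ^ 'n) (x ^ 4)"
    have "(1 - x ^ 4) powr (L / 2) * (1 - x ^ 4) powr (- L / 2) = 1"
      using x4 by (simp flip: powr_add)
    then have "T * (1 - x ^ 4) powr (- L / 2) / (1 - x) ^ ?n = 1 / 4"
      using pow x by (simp add: T_def)
    then show "infsum (gaf_term L (\<lambda>\<alpha>. a \<alpha> \<omega>) z) UNIV \<noteq> 0"
      using \<omega> z T L x by (intro gaf_nonzero[where T = T and x = x]) auto
  qed auto
  have "exp (- ((1 + c\<^sub>1 + c\<^sub>2) * (\<kappa> + 2) ^ ?n + 1) * L ^ (?n + 1)) \<le> (T\<^sup>2 / exp 1) ^ ((K + 1) ^ ?n) / 2"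
  proof -
    have "ln 128 \<ge> 2 * ln (4::real)" unfolding ln128 by simp
    moreover have "2 * real ?n * ln (1 / (1 - x)) \<le> 3 * ?n * ln (1 / (1 - x))"
      using x by (intro mult_right_mono) auto
    ultimately have "1 + 2 * ?n * ln (1 / (1 - x)) + 2 * ln 4 \<le> 1 + c\<^sub>2"
      unfolding c\<^sub>2_def by linarith
    also have "\<dots> \<le> (1 + c\<^sub>2) * L" using c L by simp
    finally have "- ln (T\<^sup>2 / exp 1) \<le> (1 + c\<^sub>1 + c\<^sub>2) * L"
      using T by (simp add: ln_div ln_realpow lnT algebra_simps)
    moreover have "real ((K + 1) ^ ?n) \<le> ((\<kappa> + 2) * L) ^ ?n"
    proof -
      have "real (K + 1) \<le> (\<kappa> + 2) * L" using K(2) L by (simp add: algebra_simps)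
      then show ?thesis unfolding of_nat_power by (intro power_mono) auto
    qed
    ultimately have "real ((K + 1) ^ ?n) * - ln (T\<^sup>2 / exp 1) \<le> ((\<kappa> + 2) * L) ^ ?n * ((1 + c\<^sub>1 + c\<^sub>2) * L)"
      using T c L \<kappa>
      by (smt (verit, best) mult_mono' mult_nonneg_nonneg mult_nonneg_nonpos of_nat_0_le_iff zero_le_power)
    also have "\<dots> = (1 + c\<^sub>1 + c\<^sub>2) * (\<kappa> + 2) ^ ?n * L ^ (?n + 1)"
      by (simp add: power_mult_distrib)
    finally have 1: "- ((1 + c\<^sub>1 + c\<^sub>2) * (\<kappa> + 2) ^ ?n * L ^ (?n + 1)) \<le> real ((K + 1) ^ ?n) * ln (T\<^sup>2 / exp 1)"
      by simp
    have "exp (real ((K + 1) ^ ?n) * ln (T\<^sup>2 / exp 1)) = exp (ln (T\<^sup>2 / exp 1)) ^ ((K + 1) ^ ?n)"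
      by (rule exp_of_nat_mult)
    also have "exp (ln (T\<^sup>2 / exp 1)) = T\<^sup>2 / exp 1"
      using T by (subst exp_ln) auto
    finally have 2: "exp (- ((1 + c\<^sub>1 + c\<^sub>2) * (\<kappa> + 2) ^ ?n * L ^ (?n + 1))) \<le> (T\<^sup>2 / exp 1) ^ ((K + 1) ^ ?n)"
      using 1 by (metis exp_le_cancel_iff)
    have "exp (- (L ^ (?n + 1))) \<le> exp (- 1 :: real)"
      using L one_le_power[of L "?n + 1"] by simp
    also have "\<dots> \<le> 1 / 2"
      using exp_ge_add_one_self[of 1] by (simp add: exp_minus field_simps)
    finally have 3: "exp (- (L ^ (?n + 1))) \<le> 1 / 2" .
    have "exp (- ((1 + c\<^sub>1 + c\<^sub>2) * (\<kappa> + 2) ^ ?n + 1) * L ^ (?n + 1))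
      = exp (- ((1 + c\<^sub>1 + c\<^sub>2) * (\<kappa> + 2) ^ ?n * L ^ (?n + 1))) * exp (- (L ^ (?n + 1)))"
      unfolding exp_add[symmetric] by (simp add: algebra_simps)
    also have "\<dots> \<le> (T\<^sup>2 / exp 1) ^ ((K + 1) ^ ?n) * (1 / 2)"
      using 2 3 by (intro mult_mono) auto
    finally show ?thesis by simp
  qed
  also have "\<dots> \<le> prob ?E"
    by (rule prob_small_coeffs_ge[OF iid x T T1 K1])
  also have "\<dots> \<le> prob (hole_event M a L (x ^ 4))"
    using x by (intro finite_measure_mono sub hole_event_measurable iid) auto
  finally show ?thesis unfolding \<kappa>_def .
qed

text \<open>A hole together with the growth bound puts \<open>\<phi> j - log_rest \<phi> j\<close>
  into a disc of radius \<open>C\<close> for every degree in \<open>J\<close>, at the price of one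
  factor per degree. The second summand accounts for failure of the growth bound.\<close>

lemma prob_hole_le:
  fixes a :: "('n::finite \<Rightarrow> nat) \<Rightarrow> 'a \<Rightarrow> complex"
  assumes iid: "iid_standard_complex_gaussians M a" and L: "L > 0" and x: "0 < x" "x < 1"
    and T: "T \<ge> 1" and B: "T * (1 - x ^ 4) powr (- L / 2) / (1 - x) ^ CARD('n) \<le> exp B" "B \<ge> 0"
    and \<rho>: "0 < \<rho>" "real CARD('n) * \<rho> < x ^ 4" and m: "m \<ge> 1" "6 * (CARD('n) * real m) \<le> \<rho>\<^sup>2 * L"
  defines "C \<equiv> 2 * exp 1 * real ((2 * m) ^ CARD('n)) * (T * (B + 1) + 1)"
  shows "prob (hole_event M a L (x ^ 4)) \<le>
    (C\<^sup>2 * exp (- (CARD('n) * real m))) ^ (m ^ CARD('n)) + 8 * exp (- T\<^sup>2 / 4) / (1 - x) ^ CARD('n)"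
proof -
  let ?n = "CARD('n)"
  obtain d :: "'n \<Rightarrow> nat" where d: "\<And>i. d i \<ge> 1"
      "inj_on (mi_weight d) (Pi\<^sub>E UNIV (\<lambda>_. {..<2 * m}))"
      "\<And>\<alpha>. \<alpha> \<in> Pi\<^sub>E UNIV (\<lambda>_. {..<2 * m}) \<Longrightarrow> mi_weight d \<alpha> < (2 * m) ^ ?n"
    using ex_digit_weights[of "2 * m", where 'n = 'n] m unfolding mi_weight_def by auto
  \<comment> \<open>Digits from \<open>m\<close> on make \<open>mi_size\<close> at least
    \<open>?n * m\<close>, hence \<open>s\<close> exponentially large; digits below
    \<open>2 * m\<close> keep it in the range of \<open>gaf_coeff_lower\<close>, by the hypothesis
    on \<open>m\<close>.\<close>
  define box where "box = Pi\<^sub>E (UNIV :: 'n set) (\<lambda>_. {m..<2 * m})"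
  have box_sub: "box \<subseteq> Pi\<^sub>E UNIV (\<lambda>_. {..<2 * m})"
    unfolding box_def by (intro PiE_mono) auto
  have inj: "inj_on (mi_weight d) box" using d(2) box_sub by (rule inj_on_subset)
  have fin: "finite box" unfolding box_def by (intro finite_PiE) auto
  have card: "card box = m ^ ?n" unfolding box_def by (subst card_PiE) auto
  define J where "J = mi_weight d ` box"
  define \<beta> where "\<beta> = inv_into box (mi_weight d)"
  have \<beta>: "\<beta> j \<in> box" "mi_weight d (\<beta> j) = j" if "j \<in> J" for j
    using that unfolding J_def \<beta>_def by (rule inv_into_into, rule f_inv_into_f)
  have size: "?n * m \<le> mi_size \<alpha>" "mi_size \<alpha> \<le> ?n * (2 * m)" if "\<alpha> \<in> box" for \<alpha>
  proof -
    have *: "m \<le> \<alpha> i" "\<alpha> i \<le> 2 * m" for i using that by (auto simp: box_def PiE_iff less_imp_le)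
    have "(\<Sum>i\<in>(UNIV :: 'n set). m) \<le> mi_size \<alpha>" "mi_size \<alpha> \<le> (\<Sum>i\<in>(UNIV :: 'n set). 2 * m)"
      unfolding mi_size_def using * by (intro sum_mono; simp)+
    then show "?n * m \<le> mi_size \<alpha>" "mi_size \<alpha> \<le> ?n * (2 * m)" by simp_all
  qed
  have J1: "j \<ge> 1" "real j + 1 \<le> real ((2 * m) ^ ?n)" if "j \<in> J" for j
  proof -
    have "mi_weight d (\<beta> j) \<ge> mi_size (\<beta> j)"
      unfolding mi_weight_def mi_size_def using d(1) by (intro sum_mono) simp
    moreover have "?n * m \<ge> 1" using m by simp
    ultimately show "j \<ge> 1" using size(1)[OF \<beta>(1)[OF that]] \<beta>(2)[OF that] by linarith
    have "j < (2 * m) ^ ?n" using d(3)[of "\<beta> j"] \<beta>[OF that] box_sub by auto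
    then have "j + 1 \<le> (2 * m) ^ ?n" by simp
    then have "real (j + 1) \<le> real ((2 * m) ^ ?n)" by (simp only: of_nat_le_iff)
    then show "real j + 1 \<le> real ((2 * m) ^ ?n)" by simp
  qed
  define s where "s = (\<lambda>\<alpha> :: 'n \<Rightarrow> nat. gaf_coeff L \<alpha> * \<rho> ^ mi_size \<alpha>)"
  have s: "s \<alpha> > 0" for \<alpha> unfolding s_def by (intro mult_pos_pos gaf_coeff_pos L zero_less_power \<rho>)
  have C: "C \<ge> 0" using T B by (simp add: C_def)
  define \<phi> where "\<phi> = (\<lambda>\<omega>. graded_sum (mi_weight d) s (\<lambda>\<alpha>. a \<alpha> \<omega>))"
  define E where "E = {\<omega>\<in>space M. \<forall>j\<in>J. cmod (\<phi> \<omega> j - log_rest (\<phi> \<omega>) j) \<le> C}"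
  define G where "G = {\<omega>\<in>space M. \<forall>\<alpha>. norm (a \<alpha> \<omega>) * x ^ mi_size \<alpha> \<le> T}"
  have [measurable]: "a \<alpha> \<in> borel_measurable M" for \<alpha> by (rule iid_gaussians(3)[OF iid])
  have [measurable]: "(\<lambda>\<omega>. \<phi> \<omega> j) \<in> borel_measurable M" for j
    unfolding \<phi>_def graded_sum_def by measurable
  have [measurable]: "(\<lambda>\<omega>. log_rest (\<phi> \<omega>) j) \<in> borel_measurable M" for j
    by (rule measurable_log_rest) measurable
  have E: "E \<in> events" unfolding E_def J_def using fin by measurable
  have G: "G \<in> events" unfolding G_def by measurable
  have "prob (hole_event M a L (x ^ 4)) \<le> prob (E \<union> (space M - G))"
  proof (rule finite_measure_mono)
    show "hole_event M a L (x ^ 4) \<subseteq> E \<union> (space M - G)"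
    proof
      fix \<omega> assume \<omega>: "\<omega> \<in> hole_event M a L (x ^ 4)"
      show "\<omega> \<in> E \<union> (space M - G)"
      proof (cases "\<omega> \<in> G")
        case True
        have "cmod (\<phi> \<omega> j - log_rest (\<phi> \<omega>) j) \<le> C" if "j \<in> J" for j
        proof -
          have "cmod (\<phi> \<omega> j - log_rest (\<phi> \<omega>) j) \<le> 2 * exp 1 * (real j + 1) * (T * (B + 1) + 1)"
            unfolding \<phi>_def s_def
            by (rule slice_log_rest_bound[OF L x d(1) _ \<rho>(2) _ _ B])
               (use \<omega> True \<rho> J1[OF that] in \<open>auto simp: G_def hole_event_def\<close>)
          also have "\<dots> \<le> C" unfolding C_def
            using J1(2)[OF that] T B by (intro mult_right_mono mult_left_mono) auto
          finally show ?thesis .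
        qed
        then show ?thesis using \<omega> by (auto simp: E_def hole_event_def)
      qed (use \<omega> in \<open>auto simp: hole_event_def\<close>)
    qed
  qed (use E G in auto)
  also have "\<dots> \<le> prob E + prob (space M - G)"
    using E G by (intro measure_Un_le) auto
  also have "prob (space M - G) = 1 - prob G" using G by (rule prob_compl)
  also have "1 - prob G \<le> 8 * exp (- T\<^sup>2 / 4) / (1 - x) ^ ?n"
    using prob_growth_ge[OF iid x T] by (simp add: G_def)
  also have "prob E \<le> (\<Prod>j\<in>J. (C / s (\<beta> j))\<^sup>2)"
    unfolding E_def \<phi>_def using fin \<beta> d(1)
    by (intro prob_log_rest_le iid_gaussians[OF iid] finite_mi_weight_eq s C) (auto simp: J_def)
  also have "\<dots> \<le> (\<Prod>j\<in>J. C\<^sup>2 * exp (- (?n * real m)))"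
  proof (intro prod_mono conjI)
    fix j assume j: "j \<in> J"
    have le: "real (mi_size (\<beta> j)) \<le> real (?n * (2 * m))" "real (?n * m) \<le> real (mi_size (\<beta> j))"
      using size[OF \<beta>(1)[OF j]] by (simp_all only: of_nat_le_iff)
    have "exp (?n * real m) \<le> exp (real (mi_size (\<beta> j)))" using le(2) by simp
    also have "\<dots> \<le> (s (\<beta> j))\<^sup>2"
      unfolding s_def using le(1) m(2) by (intro gaf_coeff_lower L \<rho>) simp
    finally have "exp (?n * real m) \<le> (s (\<beta> j))\<^sup>2" .
    then have "C\<^sup>2 / (s (\<beta> j))\<^sup>2 \<le> C\<^sup>2 / exp (?n * real m)"
      by (intro divide_left_mono mult_pos_pos) (auto intro: zero_less_power s)
    then show "(C / s (\<beta> j))\<^sup>2 \<le> C\<^sup>2 * exp (- (?n * real m))"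
      by (simp add: power_divide exp_minus field_simps)
  qed auto
  also have "\<dots> = (C\<^sup>2 * exp (- (?n * real m))) ^ (m ^ ?n)"
    using card_image[OF inj] card by (simp add: J_def)
  finally show ?thesis by simp
qed

end

text \<open>The parameters are \<open>T = exp (\<epsilon> * L)\<close>,
  \<open>B = \<kappa> * L\<close> and \<open>m\<close> about \<open>\<delta> * L\<close>. The base
  of the power in \<open>prob_hole_le\<close> is then exponentially small in \<open>L\<close> and
  its exponent is of order \<open>L ^ CARD('n)\<close>, while failure of the growth bound is doubly
  exponentially rare.\<close>

lemma hole_probability_le:
  fixes x :: real
  assumes x: "0 < x" "x < 1"
  shows "\<exists>C\<^sub>2>0. \<exists>L\<^sub>0\<ge>1. \<forall>L\<ge>L\<^sub>0. \<forall>(M :: 'w measure) (a :: ('n::finite \<Rightarrow> nat) \<Rightarrow> 'w \<Rightarrow> complex).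
    prob_space M \<longrightarrow> iid_standard_complex_gaussians M a \<longrightarrow>
      measure M (hole_event M a L (x ^ 4)) \<le> exp (- C\<^sub>2 * L ^ (CARD('n) + 1))"
proof -
  let ?n = "real CARD('n)"
  let ?N = "CARD('n)"
  have n: "?n \<ge> 1" using zero_less_card_finite[where 'a = 'n] by linarith
  have x4: "0 < x ^ 4" "x ^ 4 < 1" using x by (auto simp: power_less_one_iff)
  define \<rho> where "\<rho> = x ^ 4 / (2 * ?n)"
  have \<rho>: "\<rho> > 0" "?n * \<rho> < x ^ 4" using x n by (auto simp: \<rho>_def)
  \<comment> \<open>Makes \<open>m \<le> \<delta> * L\<close> imply
    \<open>6 * (?n * m) \<le> \<rho>\<^sup>2 * L\<close>, as \<open>prob_hole_le\<close>
    asks.\<close>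
  define \<delta> where "\<delta> = \<rho>\<^sup>2 / (6 * ?n)"
  have \<delta>: "\<delta> > 0" "6 * ?n * \<delta> = \<rho>\<^sup>2" using \<rho> n by (auto simp: \<delta>_def)
  \<comment> \<open>\<open>C\<close> will be at most \<open>exp (2 * \<epsilon> * L)\<close>, while
    \<open>?n * m\<close> is at least \<open>?n * \<delta> * L / 2 = 8 * \<epsilon> * L\<close>; so
    a decay of \<open>exp (- (4 * \<epsilon> * L))\<close> remains per coefficient.\<close>
  define \<epsilon> where "\<epsilon> = ?n * \<delta> / 16"
  have \<epsilon>: "\<epsilon> > 0" using \<delta> n by (simp add: \<epsilon>_def)
  have ln_ge: "ln (1 / (1 - x)) \<ge> 0" "ln (1 / (1 - x ^ 4)) \<ge> 0" using x x4 by (auto intro!: ln_ge_zero)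
  define \<kappa> where "\<kappa> = \<epsilon> + ln (1 / (1 - x ^ 4)) / 2 + ?n * ln (1 / (1 - x))"
  have \<kappa>: "\<kappa> \<ge> 0" using \<epsilon> ln_ge unfolding \<kappa>_def by (intro add_nonneg_nonneg mult_nonneg_nonneg) auto
  define q where "q = ln (8 / (1 - x) ^ ?N)"
  have "(1 - x) ^ ?N \<le> 1" "(1 - x) ^ ?N > 0" using x by (auto intro: power_le_one)
  then have q: "q \<ge> 0" unfolding q_def by (intro ln_ge_zero) (simp add: field_simps)
  define A where "A = 2 * exp 1 * (2 * \<delta>) ^ ?N * (\<kappa> + 2)"
  obtain L1 where L1: "L1 \<ge> 1" "\<And>L. L \<ge> L1 \<Longrightarrow> A * L ^ (?N + 1) \<le> exp (\<epsilon> * L)"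
    using ex_power_le_exp[OF \<epsilon>] by blast
  obtain L2 where L2: "L2 \<ge> 1" "\<And>L. L \<ge> L2 \<Longrightarrow> 4 * (1 + q) * L ^ (?N + 1) \<le> exp (\<epsilon> * L)"
    using ex_power_le_exp[OF \<epsilon>] by blast
  \<comment> \<open>The second entry comes from the product over the slice coefficients, the 1 from
    the failure of the growth bound.\<close>
  define c where "c = min 1 (4 * \<epsilon> * (\<delta> / 2) ^ ?N)"
  have c: "c > 0" using \<epsilon> \<delta> by (simp add: c_def)
  \<comment> \<open>\<open>L1\<close> and \<open>L2\<close> let exponentials beat the polynomial
    factors; \<open>2 / \<delta>\<close> gives \<open>m \<ge> 1\<close> and
    \<open>m \<ge> \<delta> * L / 2\<close>; \<open>2 * ln 2 / c\<close> lets half of the rate pay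
    for adding two equal bounds.\<close>
  define L\<^sub>0 where "L\<^sub>0 = Max {L1, L2, 2 / \<delta>, 2 * ln 2 / c}"
  have L0: "L1 \<le> L\<^sub>0" "L2 \<le> L\<^sub>0" "2 / \<delta> \<le> L\<^sub>0" "2 * ln 2 / c \<le> L\<^sub>0" by (auto simp: L\<^sub>0_def)
  have main: "measure M (hole_event M a L (x ^ 4)) \<le> exp (- (c / 2) * L ^ (?N + 1))"
    if L: "L \<ge> L\<^sub>0" and "prob_space M" and iid: "iid_standard_complex_gaussians M a"
    for L and M :: "'w measure" and a :: "('n \<Rightarrow> nat) \<Rightarrow> 'w \<Rightarrow> complex"
  proof -
    interpret prob_space M by fact
    have L1': "L \<ge> 1" using L L0 L1 by linarith
    define T where "T = exp (\<epsilon> * L)"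
    have T: "T \<ge> 1" using \<epsilon> L1' by (simp add: T_def)
    define m where "m = nat \<lfloor>\<delta> * L\<rfloor>"
    have "2 / \<delta> \<le> L" using L L0(3) by linarith
    then have dL: "\<delta> * L \<ge> 2" using \<delta>(1) by (simp add: field_simps)
    then have m: "real m \<le> \<delta> * L" "\<delta> * L - 1 \<le> real m" unfolding m_def by linarith+
    then have m2: "\<delta> * L / 2 \<le> real m" "m \<ge> 1" using dL by auto
    have B: "T * (1 - x ^ 4) powr (- L / 2) / (1 - x) ^ ?N \<le> exp (\<kappa> * L)"
    proof -
      have "(1 - x ^ 4) powr (- L / 2) = exp (L / 2 * ln (1 / (1 - x ^ 4)))"
        using x4 by (simp add: powr_def ln_div)
      moreover have "1 / (1 - x) ^ ?N = exp (?n * ln (1 / (1 - x)))"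
        using x by (simp add: exp_of_nat_mult power_one_over)
      ultimately have "T * (1 - x ^ 4) powr (- L / 2) / (1 - x) ^ ?N
         = T * exp (L / 2 * ln (1 / (1 - x ^ 4))) * exp (?n * ln (1 / (1 - x)))"
        by (metis times_divide_eq_right mult.right_neutral)
      also have "\<dots> = exp (\<epsilon> * L + L / 2 * ln (1 / (1 - x ^ 4)) + ?n * ln (1 / (1 - x)))"
        by (simp only: T_def exp_add)
      also have "\<dots> \<le> exp (\<kappa> * L)"
      proof -
        have "?n * ln (1 / (1 - x)) * 1 \<le> ?n * ln (1 / (1 - x)) * L"
          using L1' ln_ge by (intro mult_left_mono mult_nonneg_nonneg) auto
        then show ?thesis unfolding \<kappa>_def by (simp add: algebra_simps)
      qed
      finally show ?thesis .
    qed
    define C where "C = 2 * exp 1 * real ((2 * m) ^ ?N) * (T * (\<kappa> * L + 1) + 1)"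
    have C0: "C \<ge> 0" using T \<kappa> L1' by (simp add: C_def)
    have "C \<le> 2 * exp 1 * (2 * \<delta> * L) ^ ?N * (T * ((\<kappa> + 2) * L))"
    proof -
      have "T * (\<kappa> * L + 1) + 1 \<le> T * (\<kappa> * L + 1) + T" using T by simp
      also have "\<dots> = T * (\<kappa> * L + 2)" by (simp add: algebra_simps)
      also have "\<dots> \<le> T * ((\<kappa> + 2) * L)"
        using T L1' by (intro mult_left_mono) (auto simp: algebra_simps)
      finally have "T * (\<kappa> * L + 1) + 1 \<le> T * ((\<kappa> + 2) * L)" .
      moreover have "real ((2 * m) ^ ?N) \<le> (2 * \<delta> * L) ^ ?N"
        unfolding of_nat_power using m by (intro power_mono) auto
      ultimately show ?thesis unfolding C_def using T \<kappa> L1' \<delta>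
        by (intro mult_mono) auto
    qed
    also have "\<dots> = A * L ^ (?N + 1) * T" by (simp add: A_def power_mult_distrib)
    also have "\<dots> \<le> exp (\<epsilon> * L) * T" using L1(2)[of L] L L0(1) T by (intro mult_right_mono) auto
    finally have C: "C \<le> exp (2 * \<epsilon> * L)" by (simp add: T_def mult_ac flip: exp_add)
    have "C\<^sup>2 * exp (- (?n * m)) \<le> (exp (2 * \<epsilon> * L))\<^sup>2 * exp (- (?n * (\<delta> * L / 2)))"
      using C C0 m2 n by (intro mult_mono power_mono) auto
    also have "\<dots> = exp (- (4 * \<epsilon> * L))"
      by (simp add: \<epsilon>_def power2_eq_square flip: exp_add)
    finally have base: "C\<^sup>2 * exp (- (?n * m)) \<le> exp (- (4 * \<epsilon> * L))" .
    have "(C\<^sup>2 * exp (- (?n * m))) ^ (m ^ ?N) \<le> exp (- (4 * \<epsilon> * L)) ^ (m ^ ?N)"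
      using base by (intro power_mono) auto
    also have "\<dots> = exp (real (m ^ ?N) * - (4 * \<epsilon> * L))" by (rule exp_of_nat_mult[symmetric])
    also have "\<dots> \<le> exp (- (c * L ^ (?N + 1)))"
    proof -
      have "(\<delta> * L / 2) ^ ?N \<le> real m ^ ?N" using m2 dL by (intro power_mono) auto
      then have "(\<delta> * L / 2) ^ ?N * (4 * \<epsilon> * L) \<le> real (m ^ ?N) * (4 * \<epsilon> * L)"
        using \<epsilon> L1' by (intro mult_right_mono) auto
      moreover have "(\<delta> * L / 2) ^ ?N * (4 * \<epsilon> * L) = 4 * \<epsilon> * (\<delta> / 2) ^ ?N * L ^ (?N + 1)"
        by (simp add: power_mult_distrib power_divide)
      moreover have "c * L ^ (?N + 1) \<le> 4 * \<epsilon> * (\<delta> / 2) ^ ?N * L ^ (?N + 1)"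
        using L1' unfolding c_def by (intro mult_right_mono) auto
      ultimately show ?thesis by simp
    qed
    finally have first: "(C\<^sup>2 * exp (- (?n * m))) ^ (m ^ ?N) \<le> exp (- (c * L ^ (?N + 1)))" .
    have Lpow: "L \<le> L ^ (?N + 1)" "1 \<le> L ^ (?N + 1)"
      using L1' by (auto intro: self_le_power one_le_power simp del: power_Suc)
    have "8 * exp (- T\<^sup>2 / 4) / (1 - x) ^ ?N = exp (q - T\<^sup>2 / 4)"
    proof -
      have "exp q = 8 / (1 - x) ^ ?N" using x by (simp add: q_def)
      moreover have "exp (q - T\<^sup>2 / 4) = exp q * exp (- T\<^sup>2 / 4)"
        unfolding exp_add[symmetric] by simp
      ultimately show ?thesis by simp
    qed
    also have "\<dots> \<le> exp (- (c * L ^ (?N + 1)))"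
    proof -
      have "4 * (1 + q) * L ^ (?N + 1) \<le> T" unfolding T_def using L L0 by (intro L2) auto
      also have "T * 1 \<le> T * T" using T by (intro mult_left_mono) auto
      then have "T \<le> T\<^sup>2" by (simp add: power2_eq_square)
      finally have "L ^ (?N + 1) + q * L ^ (?N + 1) \<le> T\<^sup>2 / 4" by (simp add: algebra_simps)
      moreover have "q * 1 \<le> q * L ^ (?N + 1)" using q Lpow by (intro mult_left_mono) auto
      moreover have "c * L ^ (?N + 1) \<le> 1 * L ^ (?N + 1)"
        using L1' unfolding c_def by (intro mult_right_mono) auto
      ultimately have "q - T\<^sup>2 / 4 \<le> - (c * L ^ (?N + 1))" by linarith
      then show ?thesis by simp
    qed
    finally have second: "8 * exp (- T\<^sup>2 / 4) / (1 - x) ^ ?N \<le> exp (- (c * L ^ (?N + 1)))" .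
    have "6 * (?n * real m) \<le> 6 * (?n * (\<delta> * L))"
      using m by (intro mult_left_mono) auto
    also have "\<dots> = \<rho>\<^sup>2 * L" unfolding \<delta>(2)[symmetric] by simp
    finally have m6: "6 * (?n * real m) \<le> \<rho>\<^sup>2 * L" .
    have "prob (hole_event M a L (x ^ 4)) \<le>
        (C\<^sup>2 * exp (- (?n * m))) ^ (m ^ ?N) + 8 * exp (- T\<^sup>2 / 4) / (1 - x) ^ ?N"
      unfolding C_def using L1' \<kappa>
      by (intro prob_hole_le[OF iid _ x T B _ \<rho> m2(2) m6]) auto
    also have "\<dots> \<le> exp (- (c * L ^ (?N + 1))) + exp (- (c * L ^ (?N + 1)))"
      using first second by (rule add_mono)
    also have "\<dots> = exp (ln 2 - c * L ^ (?N + 1))" by (simp add: exp_diff exp_minus field_simps)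
    also have "\<dots> \<le> exp (- (c / 2) * L ^ (?N + 1))"
    proof -
      have "2 * ln 2 / c \<le> L ^ (?N + 1)" using L L0(4) Lpow(1) by linarith
      then have "2 * ln 2 \<le> c * L ^ (?N + 1)" using c by (simp add: field_simps)
      then show ?thesis by simp
    qed
    finally show ?thesis .
  qed
  have "c / 2 > 0" using c by simp
  moreover have "L\<^sub>0 \<ge> 1" using L1 L0 by linarith
  ultimately show ?thesis using main by blast
qed

theorem theorem4:
  fixes r :: real
  assumes "0 < r" and "r < 1"
  shows "\<exists>C\<^sub>1>0. \<exists>C\<^sub>2>0. \<exists>L\<^sub>0::real.
    \<forall>L\<ge>L\<^sub>0. \<forall>(M :: 'w measure) (a :: ('n::finite \<Rightarrow> nat) \<Rightarrow> 'w \<Rightarrow> complex).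
      L > 0 \<longrightarrow> prob_space M \<longrightarrow> iid_standard_complex_gaussians M a \<longrightarrow>
        exp (- C\<^sub>1 * L ^ (CARD('n) + 1))
          \<le> \<P>(\<omega> in M. zero_set (hyperbolic_GAF L a \<omega>) \<inter> ball 0 r = {}) \<and>
        \<P>(\<omega> in M. zero_set (hyperbolic_GAF L a \<omega>) \<inter> ball 0 r = {})
          \<le> exp (- C\<^sub>2 * L ^ (CARD('n) + 1))"
proof -
  \<comment> \<open>The fourth root matches the radius \<open>x ^ 4\<close> of the estimates for
    both directions.\<close>
  define x where "x = root 4 r"
  have x: "0 < x" "x < 1" "x ^ 4 = r" using assms by (auto simp: x_def)
  let ?n = "CARD('n)"
  define c\<^sub>1 c\<^sub>2 where "c\<^sub>1 = ln (1 / (1 - x ^ 4))" and "c\<^sub>2 = 3 * ?n * ln (1 / (1 - x)) + ln 128"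
  define C\<^sub>1 where "C\<^sub>1 = (1 + c\<^sub>1 + c\<^sub>2) * ((c\<^sub>1 + c\<^sub>2) / ln (1 / x) + 2) ^ ?n + 1"
  have "ln (1 / (1 - x)) \<ge> 0" "ln (1 / (1 - x ^ 4)) \<ge> 0" using x assms by (auto intro!: ln_ge_zero)
  then have "c\<^sub>1 \<ge> 0" "c\<^sub>2 \<ge> 0" "ln (1 / x) > 0"
    using x unfolding c\<^sub>1_def c\<^sub>2_def by (auto intro!: add_nonneg_nonneg mult_nonneg_nonneg)
  then have "C\<^sub>1 > 0" unfolding C\<^sub>1_def by (intro add_nonneg_pos) auto
  moreover have lower: "exp (- C\<^sub>1 * L ^ (?n + 1)) \<le> measure M (hole_event M a L r)"
    if "L \<ge> 1" "prob_space M" "iid_standard_complex_gaussians M a"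
    for L and M :: "'w measure" and a :: "('n \<Rightarrow> nat) \<Rightarrow> 'w \<Rightarrow> complex"
    using prob_space.prob_hole_ge[OF that(2,3,1) x(1,2)] unfolding C\<^sub>1_def c\<^sub>1_def c\<^sub>2_def x(3) by simp
  \<comment> \<open>Since \<open>L\<^sub>0 \<ge> 1\<close>, this threshold also serves the lower
    bound, which holds from \<open>L = 1\<close> on.\<close>
  moreover obtain C\<^sub>2 L\<^sub>0 where "C\<^sub>2 > 0" "L\<^sub>0 \<ge> 1"
    and upper: "\<And>L (M :: 'w measure) (a :: ('n \<Rightarrow> nat) \<Rightarrow> 'w \<Rightarrow> complex). L \<ge> L\<^sub>0 \<Longrightarrow> prob_space M \<Longrightarrow>
      iid_standard_complex_gaussians M a \<Longrightarrow> measure M (hole_event M a L r) \<le> exp (- C\<^sub>2 * L ^ (?n + 1))"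
    using hole_probability_le[OF x(1,2), where 'w = 'w and 'n = 'n] unfolding x(3) by blast
  ultimately show ?thesis
    unfolding hole_event_eq[OF assms(2)]
    by (intro exI[of _ C\<^sub>1] exI[of _ C\<^sub>2] conjI exI[of _ L\<^sub>0] allI impI lower upper) auto
qed

end
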